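(* Let $K$ be a field, let $n_1<n_2<n_3<n_4$ be positive integers with $\gcd(n_1,n_2,n_3,n_4)=1$, and let $C$ be the monomial curve $x_i=t^{n_i}$ ($1\le i\le 4$) in $\mathbb{A}^4(K)$. Assume that $C$ is Gorenstein and not a complete intersection, that $C$ has Cohen-Macaulay tangent cone at the origin, and that $I(C)$ is minimally generated by $$f_1=x_1^{a_1}-x_2^{a_{12}}x_4^{a_{14}},\quad f_2=x_2^{a_2}-x_3^{a_{23}}x_4^{a_{24}},\quad f_3=x_3^{a_3}-x_1^{a_{31}}x_2^{a_{32}},$$ $$f_4=x_4^{a_4}-x_1^{a_{41}}x_3^{a_{43}},\quad f_5=x_1^{a_{31}}x_4^{a_{24}}-x_2^{a_{12}}x_3^{a_{43}},$$ where $a_i>1$ and $0<a_{ij}<a_j$ for all the exponents appearing. Suppose that $a_{43}\le a_{23}$. Let $p_5=x_2^{a_{12}}x_3^{a_{43}}$ if $a_{12}+a_{43}<a_{31}+a_{24}$ and $p_5=x_1^{a_{31}}x_4^{a_{24}}-x_2^{a_{12}}x_3^{a_{43}}$ if $a_{12}+a_{43}=a_{31}+a_{24}$. (i) Assume $a_{24}<a_{14}$. If $a_3\le a_{31}+a_{32}$, $a_{12}+a_{43}\le a_{31}+a_{24}$ and $a_2+a_{12}\le a_{31}+a_{23}-a_{43}+2a_{24}$, then $I(C)_*$ is minimally generated by the six polynomials $$G_*=\{x_2^{a_{12}}x_4^{a_{14}},\ x_3^{a_{23}}x_4^{a_{24}},\ x_3^{a_3},\ x_4^{a_4},\ p_5,\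 p_6\},$$ where $p_6=x_2^{a_2+a_{12}}$ if $a_2+a_{12}<a_{31}+a_{23}-a_{43}+2a_{24}$ and $p_6=x_2^{a_2+a_{12}}-x_1^{a_{31}}x_3^{a_{23}-a_{43}}x_4^{2a_{24}}$ if $a_2+a_{12}=a_{31}+a_{23}-a_{43}+2a_{24}$. (ii) Assume $a_{14}\le a_{24}$. If $a_3\le a_{31}+a_{32}$, $a_{12}+a_{43}\le a_{31}+a_{24}$ and $a_2+a_{12}\le a_1+a_{23}+a_{24}-a_{14}$, then $I(C)_*$ is minimally generated by the six polynomials $$G_*=\{x_2^{a_{12}}x_4^{a_{14}},\ x_3^{a_{23}}x_4^{a_{24}},\ x_3^{a_3},\ x_4^{a_4},\ p_5,\ p_6\},$$ where $p_6=x_2^{a_2+a_{12}}$ if $a_2+a_{12}<a_1+a_{23}+a_{24}-a_{14}$ and $p_6=x_2^{a_2+a_{12}}-x_1^{a_1}x_3^{a_{23}}x_4^{a_{24}-a_{14}}$ if $a_2+a_{12}=a_1+a_{23}+a_{24}-a_{14}$.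
   Context: $I(C)$ is the kernel of the $K$-algebra homomorphism $\phi:K[x_1,\ldots,x_4]\to K[t]$, $\phi(x_i)=t^{n_i}$. $C$ is Gorenstein when the numerical semigroup generated by $n_1,\ldots,n_4$ is symmetric, and it is not a complete intersection when $I(C)$ cannot be generated by three elements. For $0\ne f\in I(C)$, $f_*$ denotes the homogeneous summand of $f$ of least (standard) degree, and $I(C)_*$ is the ideal of $K[x_1,\ldots,x_4]$ generated by all $f_*$, $f\in I(C)$; it is the defining ideal of the tangent cone of $C$ at the origin. $C$ has Cohen-Macaulay tangent cone at the origin if $K[x_1,\ldots,x_4]/I(C)_*$ is Cohen-Macaulay. In the described situation the exponents satisfy (Bresinsky) $a_1=a_{31}+a_{41}$, $a_2=a_{12}+a_{32}$, $a_3=a_{23}+a_{43}$, $a_4=a_{14}+a_{24}$. *)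

theory Defs
  imports
    "HOL-Library.Poly_Mapping"
    "HOL-Library.Numeral_Type"
    "HOL-Library.Extended_Nat"
    "HOL-Computational_Algebra.Polynomial"
    "HOL-Algebra.Algebraic_Closure_Type"
begin

section \<open>The polynomial ring in four variables\<close>

text \<open>The variables are indexed by the four-element type \<open>4\<close>, whose elements are the pairwise
  distinct numerals \<open>1, 2, 3, 4\<close> (in this type \<open>4 = 0\<close>).  An exponent vector is a finitely
  supported function on this type, a polynomial a finitely supported function on exponent
  vectors.\<close>

type_synonym 'k mpoly4 = "(4 \<Rightarrow>\<^sub>0 nat) \<Rightarrow>\<^sub>0 'k"

definition Var :: "4 \<Rightarrow> 'k::comm_ring_1 mpoly4" where
  "Var i = Poly_Mapping.single (Poly_Mapping.single i 1) 1"

abbreviation ideal_of :: "'r::comm_ring_1 set \<Rightarrow> 'r set" where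
  "ideal_of G \<equiv> genideal ring_of_type_algebra G"

text \<open>A list is used so that the number of generators is part of the claim: the entries must be
  pairwise distinct and none of them can be omitted.\<close>

definition minimally_generates :: "'r::comm_ring_1 list \<Rightarrow> 'r set \<Rightarrow> bool" where
  "minimally_generates gs I \<longleftrightarrow>
     distinct gs \<and> ideal_of (set gs) = I \<and> (\<forall>g\<in>set gs. ideal_of (set gs - {g}) \<noteq> I)"

definition total_degree :: "(4 \<Rightarrow>\<^sub>0 nat) \<Rightarrow> nat" where
  "total_degree m = (\<Sum>i\<in>UNIV. Poly_Mapping.lookup m i)"

definition homogeneous_summand :: "nat \<Rightarrow> 'k::field mpoly4 \<Rightarrow> 'k mpoly4" where
  "homogeneous_summand d f =
     (\<Sum>m\<in>{m \<in> Poly_Mapping.keys f. total_degree m = d}.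
        Poly_Mapping.single m (Poly_Mapping.lookup f m))"

definition initial_form :: "'k::field mpoly4 \<Rightarrow> 'k mpoly4" where
  "initial_form f = homogeneous_summand (LEAST d. homogeneous_summand d f \<noteq> 0) f"

definition initial_ideal :: "'k::field mpoly4 set \<Rightarrow> 'k mpoly4 set" where
  "initial_ideal I = ideal_of {initial_form f | f. f \<in> I \<and> f \<noteq> 0}"


section \<open>Monomial curves in affine four-space\<close>

text \<open>The \<open>K\<close>-algebra homomorphism sending the \<open>i\<close>-th variable to \<open>t ^ n i\<close>, given by
  substitution.\<close>

definition curve_hom :: "(4 \<Rightarrow> nat) \<Rightarrow> 'k::field mpoly4 \<Rightarrow> 'k poly" where
  "curve_hom n f =
     (\<Sum>m\<in>Poly_Mapping.keys f.
        smult (Poly_Mapping.lookup f m)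
          (\<Prod>i\<in>UNIV. (Polynomial.monom 1 (n i)) ^ Poly_Mapping.lookup m i))"

lemma curve_hom_Var: "curve_hom n (Var i :: 'k::field mpoly4) = Polynomial.monom 1 (n i)"
proof -
  have "(\<Prod>j\<in>UNIV. (Polynomial.monom (1::'k) (n j)) ^ Poly_Mapping.lookup (Poly_Mapping.single i 1) j)
      = (\<Prod>j\<in>UNIV. if j = i then Polynomial.monom (1::'k) (n j) else 1)"
    by (rule prod.cong) (auto simp: lookup_single when_def)
  then show ?thesis
    by (simp add: curve_hom_def Var_def)
qed

definition curve_ideal :: "(4 \<Rightarrow> nat) \<Rightarrow> 'k::field mpoly4 set" where
  "curve_ideal n = a_kernel ring_of_type_algebra ring_of_type_algebra (curve_hom n)"

definition value_semigroup :: "(4 \<Rightarrow> nat) \<Rightarrow> nat set" where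
  "value_semigroup n = {(\<Sum>i\<in>UNIV. c i * n i) | c. True}"

text \<open>The Frobenius number is the largest integer outside the semigroup, so it is \<open>-1\<close> for the
  semigroup of all natural numbers.\<close>

definition frobenius_number :: "nat set \<Rightarrow> int" where
  "frobenius_number S = (GREATEST z. z \<notin> int ` S)"

definition symmetric_semigroup :: "nat set \<Rightarrow> bool" where
  "symmetric_semigroup S \<longleftrightarrow>
     (\<forall>z::int. z \<in> int ` S \<longleftrightarrow> frobenius_number S - z \<notin> int ` S)"

definition gorenstein_curve :: "(4 \<Rightarrow> nat) \<Rightarrow> bool" where
  "gorenstein_curve n \<longleftrightarrow> symmetric_semigroup (value_semigroup n)"


section \<open>Cohen-Macaulay rings\<close>

definition regular_sequence :: "('a, 'm) ring_scheme \<Rightarrow> 'a list \<Rightarrow> bool" where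
  "regular_sequence R rs \<longleftrightarrow>
     set rs \<subseteq> carrier R \<and>
     (\<forall>i<length rs. \<forall>r\<in>carrier R.
        rs ! i \<otimes>\<^bsub>R\<^esub> r \<in> genideal R (set (take i rs)) \<longrightarrow> r \<in> genideal R (set (take i rs))) \<and>
     genideal R (set rs) \<noteq> carrier R"

definition ideal_depth :: "('a, 'm) ring_scheme \<Rightarrow> 'a set \<Rightarrow> enat" where
  "ideal_depth R I = Sup {enat (length rs) | rs. regular_sequence R rs \<and> set rs \<subseteq> I}"

definition prime_height :: "('a, 'm) ring_scheme \<Rightarrow> 'a set \<Rightarrow> enat" where
  "prime_height R P =
     Sup {enat k | k Ps. length Ps = Suc k \<and> (\<forall>Q\<in>set Ps. primeideal Q R) \<and>
                         sorted_wrt (\<subset>) Ps \<and> last Ps = P}"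

text \<open>The definition of Cohen-Macaulay rings in Eisenbud, \<^emph>\<open>Commutative Algebra\<close>, Section 18.2:
  depth and codimension agree at every maximal ideal of the Noetherian ring.  Depths are taken in
  the ring itself, so no localization is involved.\<close>

definition cohen_macaulay_ring :: "('a, 'm) ring_scheme \<Rightarrow> bool" where
  "cohen_macaulay_ring R \<longleftrightarrow>
     cring R \<and> noetherian_ring R \<and>
     (\<forall>M. maximalideal M R \<longrightarrow> ideal_depth R M = prime_height R M)"

end

theory Submission
  imports Defs
begin

text \<open>Orient the five generators and the sixth binomial \<open>f\<^sub>6\<close>, obtained from the S-pair of \<open>f\<^sub>2\<close> and
  \<open>f\<^sub>5\<close>, as rewriting rules on monomials, from the term of smaller total degree to the other one, ties
  being broken by the exponent of \<open>x\<^sub>1\<close>.  All rules preserve the weight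
  \<open>n\<^sub>1u\<^sub>1 + \<dots> + n\<^sub>4u\<^sub>4\<close>, so rewriting terminates, and all critical pairs are joinable once the
  relations \<open>a\<^sub>1 = a\<^sub>3\<^sub>1 + a\<^sub>4\<^sub>1\<close>, \<open>a\<^sub>2 = a\<^sub>1\<^sub>2 + a\<^sub>3\<^sub>2\<close>, \<open>a\<^sub>3 = a\<^sub>2\<^sub>3 + a\<^sub>4\<^sub>3\<close>, \<open>a\<^sub>4 = a\<^sub>1\<^sub>4 + a\<^sub>2\<^sub>4\<close> are
  known.  These hold because a difference would put into \<open>I(C)\<close> a binomial with a pure power too small
  to be divisible by a term of a generator.  Since \<open>f\<^sub>1, \<dots>, f\<^sub>5\<close> generate \<open>I(C)\<close>, monomials of equal
  weight are joinable and hence share a normal form.  Normal forms have maximal total degree within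
  their weight, so subtracting them shows that every initial form is a combination of the initial
  forms of the six rules.\<close>


section \<open>Ideals of type-class rings\<close>

lemma ideal_ideal_of: "ideal (ideal_of G) (ring_of_type_algebra :: 'r::comm_ring_1 ring)"
proof -
  interpret R: ring "ring_of_type_algebra :: 'r ring" by (rule ring_from_type_algebra)
  show ?thesis by (rule R.genideal_ideal) (simp add: ring_of_type_algebra_def)
qed

lemma ideal_of_superset: "G \<subseteq> ideal_of (G :: 'r::comm_ring_1 set)"
proof -
  interpret R: ring "ring_of_type_algebra :: 'r ring" by (rule ring_from_type_algebra)
  show ?thesis by (rule R.genideal_self) (simp add: ring_of_type_algebra_def)
qed

lemma ideal_of_zero: "0 \<in> ideal_of (G :: 'r::comm_ring_1 set)"
  using additive_subgroup.zero_closed[OF ideal.axioms(1)[OF ideal_ideal_of[of G]]]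
  by (simp add: ring_of_type_algebra_def)

lemma ideal_of_add: "x \<in> ideal_of G \<Longrightarrow> y \<in> ideal_of G \<Longrightarrow> x + y \<in> ideal_of (G :: 'r::comm_ring_1 set)"
  using additive_subgroup.a_closed[OF ideal.axioms(1)[OF ideal_ideal_of[of G]], of x y]
  by (simp add: ring_of_type_algebra_def)

lemma ideal_of_mult: "x \<in> ideal_of G \<Longrightarrow> y * x \<in> ideal_of (G :: 'r::comm_ring_1 set)"
  using ideal.I_l_closed[OF ideal_ideal_of[of G], of x y]
  by (simp add: ring_of_type_algebra_def)

lemma ideal_of_uminus: "x \<in> ideal_of G \<Longrightarrow> - x \<in> ideal_of (G :: 'r::comm_ring_1 set)"
  using ideal_of_mult[of x G "-1"] by simp

lemma ideal_of_sum:
  "(\<And>a. a \<in> A \<Longrightarrow> f a \<in> ideal_of G) \<Longrightarrow> sum f A \<in> ideal_of (G :: 'r::comm_ring_1 set)"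
  by (induction A rule: infinite_finite_induct) (auto intro: ideal_of_zero ideal_of_add)

text \<open>Reduces minimality of the generated ideal to closure under sums and multiples; negatives
  come from multiplication by -1.\<close>

lemma ideal_of_least:
  fixes Z :: "'r::comm_ring_1 set"
  assumes "0 \<in> Z" "\<And>x y. x \<in> Z \<Longrightarrow> y \<in> Z \<Longrightarrow> x + y \<in> Z" "\<And>x y. x \<in> Z \<Longrightarrow> y * x \<in> Z" "G \<subseteq> Z"
  shows "ideal_of G \<subseteq> Z"
proof -
  interpret R: ring "ring_of_type_algebra :: 'r ring" by (rule ring_from_type_algebra)
  have ops: "monoid.mult (ring_of_type_algebra :: 'r ring) = (*)" "ring.add (ring_of_type_algebra :: 'r ring) = (+)"
      "carrier (ring_of_type_algebra :: 'r ring) = UNIV" "\<zero>\<^bsub>(ring_of_type_algebra :: 'r ring)\<^esub> = 0"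
    by (simp_all add: ring_of_type_algebra_def)
  have neg: "\<ominus>\<^bsub>(ring_of_type_algebra :: 'r ring)\<^esub> x = - x" for x
    by (rule R.minus_equality) (simp_all add: ring_of_type_algebra_def)
  have "ideal Z (ring_of_type_algebra :: 'r ring)"
  proof (rule idealI)
    show "subgroup Z (add_monoid (ring_of_type_algebra :: 'r ring))"
      using assms(1,2) assms(3)[where y = "-1"]
      by (intro R.add.subgroupI) (auto simp: ops neg simp flip: a_inv_def)
  qed (use assms(3) in \<open>auto simp: ops R.ring_axioms mult.commute\<close>)
  then show ?thesis
    using R.genideal_minimal assms(4) by blast
qed

lemma ideal_of_subset_ideal_of:
  "G \<subseteq> ideal_of H \<Longrightarrow> ideal_of G \<subseteq> ideal_of (H :: 'r::comm_ring_1 set)"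
  by (rule ideal_of_least) (auto intro: ideal_of_zero ideal_of_add ideal_of_mult)


section \<open>Sums of coefficients\<close>

text \<open>A linear functional used with three predicates: equality picks out a coefficient, a
  weight class gives a coefficient of the image in K[t], and a joinability class gives an invariant
  that vanishes on the curve ideal.\<close>

definition coeff_sum :: "('m \<Rightarrow> bool) \<Rightarrow> ('m \<Rightarrow>\<^sub>0 'k::comm_monoid_add) \<Rightarrow> 'k" where
  "coeff_sum P f = (\<Sum>m | m \<in> Poly_Mapping.keys f \<and> P m. Poly_Mapping.lookup f m)"

lemma coeff_sum_superset:
  assumes "finite A" "Poly_Mapping.keys f \<subseteq> A"
  shows "coeff_sum P f = (\<Sum>m | m \<in> A \<and> P m. Poly_Mapping.lookup f m)"
  unfolding coeff_sum_def
  by (rule sum.mono_neutral_left) (use assms in \<open>auto simp: in_keys_iff\<close>)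

lemma coeff_sum_add: "coeff_sum P (f + g) = coeff_sum P f + coeff_sum P g"
proof -
  let ?A = "Poly_Mapping.keys f \<union> Poly_Mapping.keys g"
  have *: "coeff_sum P h = (\<Sum>m | m \<in> ?A \<and> P m. Poly_Mapping.lookup h m)" if "Poly_Mapping.keys h \<subseteq> ?A" for h
    by (rule coeff_sum_superset) (use that in auto)
  then show ?thesis
    by (simp only: keys_add[of f g] * Un_upper1 Un_upper2 lookup_add sum.distrib)
qed

lemma coeff_sum_zero [simp]: "coeff_sum P 0 = 0"
  by (simp add: coeff_sum_def)

lemma coeff_sum_single: "coeff_sum P (Poly_Mapping.single m c) = (if P m then c else 0)"
proof -
  have "{k. k \<in> {m} \<and> P k} = (if P m then {m} else {})" by auto
  then show ?thesis
    by (subst coeff_sum_superset[of "{m}"]) simp_all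
qed

lemma coeff_sum_diff:
  "coeff_sum P (f - g) = coeff_sum P f - coeff_sum P (g :: 'm \<Rightarrow>\<^sub>0 'k::ab_group_add)"
  using coeff_sum_add[of P "f - g" g] by simp

lemma coeff_sum_eq: "coeff_sum (\<lambda>m. m = v) f = Poly_Mapping.lookup f v"
proof -
  have "{m. m \<in> Poly_Mapping.keys f \<and> m = v} = (if v \<in> Poly_Mapping.keys f then {v} else {})" by auto
  then show ?thesis
    by (simp add: coeff_sum_def in_keys_iff)
qed

lemma poly_mapping_sum_single:
  "(\<Sum>m\<in>Poly_Mapping.keys f. Poly_Mapping.single m (Poly_Mapping.lookup f m)) = f"
  by (rule poly_mapping_eqI) (simp add: lookup_sum lookup_single when_def in_keys_iff)

text \<open>The polynomials all of whose multiples are killed by the functional form an ideal; by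
  linearity, monomial multiples suffice to put the generators into it.\<close>

lemma coeff_sum_ideal_of:
  fixes G :: "('m::comm_monoid_add \<Rightarrow>\<^sub>0 'k::comm_ring_1) set"
  assumes "f \<in> ideal_of G"
    and G: "\<And>g u c. g \<in> G \<Longrightarrow> coeff_sum P (Poly_Mapping.single u c * g) = 0"
  shows "coeff_sum P f = 0"
proof -
  let ?Z = "{f. \<forall>h. coeff_sum P (h * f) = 0}"
  have "coeff_sum P (h * g) = 0" if "g \<in> G" for g h
  proof -
    have "coeff_sum P (\<Sum>m\<in>A. Poly_Mapping.single m (Poly_Mapping.lookup h m) * g) = 0" for A
      by (induction A rule: infinite_finite_induct) (simp_all add: coeff_sum_add G that)
    then show ?thesis
      by (metis poly_mapping_sum_single sum_distrib_right)
  qed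
  then have "ideal_of G \<subseteq> ?Z"
    by (intro ideal_of_least)
      (auto simp: coeff_sum_add distrib_left mult.assoc[symmetric])
  then have "coeff_sum P (1 * f) = 0"
    using assms(1) by blast
  then show ?thesis by simp
qed

lemma lookup_single_mult_eq_0:
  fixes g :: "'m::comm_monoid_add \<Rightarrow>\<^sub>0 'k::comm_ring_1"
  assumes "\<And>m. m \<in> Poly_Mapping.keys g \<Longrightarrow> v \<noteq> m + u"
  shows "Poly_Mapping.lookup (Poly_Mapping.single u c * g) v = 0"
proof (rule ccontr)
  assume "\<not> ?thesis"
  then have "v \<in> Poly_Mapping.keys (Poly_Mapping.single u c * g)"
    by (simp add: in_keys_iff)
  then obtain m where "m \<in> Poly_Mapping.keys g" "v = u + m"
    using keys_mult[of "Poly_Mapping.single u c" g] by (auto split: if_splits)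
  then show False
    using assms by (simp add: add.commute)
qed

text \<open>The coefficient at \<open>v\<close> vanishes on every monomial multiple of a generator.
  This serves both for minimality and for the relations between the exponents.\<close>

lemma lookup_ideal_of_eq_0:
  fixes G :: "('m::comm_monoid_add \<Rightarrow>\<^sub>0 'k::comm_ring_1) set"
  assumes "f \<in> ideal_of G"
    and "\<And>g m u. g \<in> G \<Longrightarrow> m \<in> Poly_Mapping.keys g \<Longrightarrow> v \<noteq> m + u"
  shows "Poly_Mapping.lookup f v = 0"
  using coeff_sum_ideal_of[of f G "\<lambda>m. m = v"] assms
  by (simp add: coeff_sum_eq lookup_single_mult_eq_0)

text \<open>The monomial \<open>vs ! i\<close> witnesses that \<open>ps ! i\<close> cannot be
  omitted: it occurs in \<open>ps ! i\<close>, but in no element of the ideal generated by the other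
  entries.\<close>

lemma minimally_generatesI:
  fixes ps :: "('m::comm_monoid_add \<Rightarrow>\<^sub>0 'k::comm_ring_1) list"
  assumes coeff: "\<And>i. i < length ps \<Longrightarrow> Poly_Mapping.lookup (ps ! i) (vs ! i) \<noteq> 0"
    and ndvd: "\<And>i j m u. i < length ps \<Longrightarrow> j < length ps \<Longrightarrow> i \<noteq> j \<Longrightarrow>
      m \<in> Poly_Mapping.keys (ps ! j) \<Longrightarrow> vs ! i \<noteq> m + u"
  shows "minimally_generates ps (ideal_of (set ps))"
  unfolding minimally_generates_def
proof (intro conjI ballI)
  show "distinct ps"
    unfolding distinct_conv_nth
    \<comment> \<open>With trivial cofactor, the witness of one entry is not a term of another, so
      the entries differ.\<close>
    using coeff ndvd[where u = 0] by (metis add.right_neutral in_keys_iff)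
  fix g assume "g \<in> set ps"
  then obtain i where i: "i < length ps" "g = ps ! i"
    by (metis in_set_conv_nth)
  have "g \<notin> ideal_of (set ps - {g})"
  proof
    assume "g \<in> ideal_of (set ps - {g})"
    then have "Poly_Mapping.lookup g (vs ! i) = 0"
    proof (rule lookup_ideal_of_eq_0)
      fix h m u assume "h \<in> set ps - {g}" "m \<in> Poly_Mapping.keys h"
      then show "vs ! i \<noteq> m + u"
        using ndvd i by (metis DiffE in_set_conv_nth singletonI)
    qed
    then show False
      using coeff i by simp
  qed
  then show "ideal_of (set ps - {g}) \<noteq> ideal_of (set ps)"
    using ideal_of_superset[of "set ps"] \<open>g \<in> set ps\<close> by blast
qed simp


section \<open>Terminating rewriting\<close>

text \<open>Newman's lemma. Local confluence joins the two first steps at \<open>v\<close>; the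
  induction hypothesis at \<open>y1\<close> joins \<open>y\<close> with \<open>v\<close>, and at
  \<open>z1\<close> joins the result with \<open>z\<close>.\<close>

lemma newman:
  assumes wf: "wf (S\<inverse>)"
    and local_confl: "\<And>x y z. (x, y) \<in> S \<Longrightarrow> (x, z) \<in> S \<Longrightarrow> \<exists>v. (y, v) \<in> S\<^sup>* \<and> (z, v) \<in> S\<^sup>*"
    and "(x, y) \<in> S\<^sup>*" "(x, z) \<in> S\<^sup>*"
  shows "\<exists>v. (y, v) \<in> S\<^sup>* \<and> (z, v) \<in> S\<^sup>*"
  using wf assms(3,4)
proof (induction x arbitrary: y z rule: wf_induct_rule)
  case (less x)
  show ?case
  proof (cases "x = y \<or> x = z")
    case True
    then show ?thesis using less.prems by blast
  next
    case False
    then obtain y1 z1 where y1: "(x, y1) \<in> S" "(y1, y) \<in> S\<^sup>*" and z1: "(x, z1) \<in> S" "(z1, z) \<in> S\<^sup>*"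
      using less.prems by (metis converse_rtranclE)
    then obtain v where v: "(y1, v) \<in> S\<^sup>*" "(z1, v) \<in> S\<^sup>*"
      using local_confl by blast
    obtain p where p: "(y, p) \<in> S\<^sup>*" "(v, p) \<in> S\<^sup>*"
      using less.IH[of y1 y v] y1 v by blast
    obtain q where q: "(p, q) \<in> S\<^sup>*" "(z, q) \<in> S\<^sup>*"
      using less.IH[of z1 p z] z1 v p by (meson converse_iff rtrancl_trans)
    show ?thesis
      using p q by (meson rtrancl_trans)
  qed
qed

lemma ex_normal_form:
  assumes "wf (S\<inverse>)"
  shows "\<exists>s. (x, s) \<in> S\<^sup>* \<and> s \<notin> Domain S"
  using assms
proof (induction x rule: wf_induct_rule)
  case (less x)
  show ?case
  proof (cases "x \<in> Domain S")
    case True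
    then show ?thesis using less.IH by (meson DomainE converse_iff converse_rtrancl_into_rtrancl)
  qed auto
qed

text \<open>Exponent vectors are written additively, so \<open>u\<close> is the monomial cofactor
  next to which a rule is applied.\<close>

definition rewrite_step :: "('m::plus \<times> 'm) set \<Rightarrow> ('m \<times> 'm) set" where
  "rewrite_step R = {(l + u, r + u) | l r u. (l, r) \<in> R}"

text \<open>Reflexive and symmetric for every \<open>S\<close>; transitivity will come from
  confluence.\<close>

definition joinable :: "('m \<times> 'm) set \<Rightarrow> 'm \<Rightarrow> 'm \<Rightarrow> bool" where
  "joinable S x y \<longleftrightarrow> (\<exists>z. (x, z) \<in> S\<^sup>* \<and> (y, z) \<in> S\<^sup>*)"

lemma joinable_refl: "joinable S x x"
  by (auto simp: joinable_def)

lemma joinable_sym: "joinable S x y \<Longrightarrow> joinable S y x"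
  by (auto simp: joinable_def)

lemma rewrite_stepI: "(l, r) \<in> R \<Longrightarrow> (l + u, r + u) \<in> rewrite_step R"
  by (auto simp: rewrite_step_def)

lemma rewrite_steps_add:
  fixes R :: "('m::comm_monoid_add \<times> 'm) set"
  shows "(x, y) \<in> (rewrite_step R)\<^sup>* \<Longrightarrow> (x + w, y + w) \<in> (rewrite_step R)\<^sup>*"
proof (induction rule: rtrancl_induct)
  case (step y z)
  then obtain l r u where "(l, r) \<in> R" "y = l + u" "z = r + u"
    by (auto simp: rewrite_step_def)
  then have "(y + w, z + w) \<in> rewrite_step R"
    using rewrite_stepI[of l r R "u + w"] by (simp add: add.assoc)
  then show ?case using step.IH by simp
qed simp

lemma joinable_add:
  fixes R :: "('m::comm_monoid_add \<times> 'm) set"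
  shows "joinable (rewrite_step R) x y \<Longrightarrow> joinable (rewrite_step R) (x + w) (y + w)"
  unfolding joinable_def using rewrite_steps_add by blast

text \<open>A common multiple of two monomials is a multiple of their least common multiple. The
  truncated difference \<open>l' - l\<close> is the cofactor of \<open>l\<close> in the latter, and
  \<open>w\<close> is what remains.\<close>

lemma add_eq_add_decompose:
  fixes l l' u u' :: "'i \<Rightarrow>\<^sub>0 nat"
  assumes "l + u = l' + u'"
  obtains w where "u = (l' - l) + w" "u' = (l - l') + w"
proof
  have *: "Poly_Mapping.lookup l i + Poly_Mapping.lookup u i = Poly_Mapping.lookup l' i + Poly_Mapping.lookup u' i" for i
    using assms by (metis lookup_add)
  have "Poly_Mapping.lookup u i = (Poly_Mapping.lookup l' i - Poly_Mapping.lookup l i) +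
      (Poly_Mapping.lookup u i - (Poly_Mapping.lookup l' i - Poly_Mapping.lookup l i))"
    "Poly_Mapping.lookup u' i = (Poly_Mapping.lookup l i - Poly_Mapping.lookup l' i) +
      (Poly_Mapping.lookup u i - (Poly_Mapping.lookup l' i - Poly_Mapping.lookup l i))" for i
    using *[of i] by linarith+
  then show "u = (l' - l) + (u - (l' - l))" "u' = (l - l') + (u - (l' - l))"
    by (auto intro!: poly_mapping_eqI simp: lookup_add lookup_minus)
qed

text \<open>The two monomials compared are the two rewritings of the least common multiple of \<open>l\<close> and \<open>l'\<close>.\<close>

lemma rewrite_step_locally_confluent:
  fixes R :: "(('i \<Rightarrow>\<^sub>0 nat) \<times> ('i \<Rightarrow>\<^sub>0 nat)) set"
  assumes "\<And>l r l' r'. (l, r) \<in> R \<Longrightarrow> (l', r') \<in> R \<Longrightarrow>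
      joinable (rewrite_step R) (r + (l' - l)) (r' + (l - l'))"
    and "(x, y) \<in> rewrite_step R" "(x, z) \<in> rewrite_step R"
  shows "\<exists>v. (y, v) \<in> (rewrite_step R)\<^sup>* \<and> (z, v) \<in> (rewrite_step R)\<^sup>*"
proof -
  obtain l r u l' r' u' where lr: "(l, r) \<in> R" "(l', r') \<in> R" and "x = l + u" "x = l' + u'"
      and yz: "y = r + u" "z = r' + u'"
    using assms(2,3) unfolding rewrite_step_def by blast
  then obtain w where "u = (l' - l) + w" "u' = (l - l') + w"
    by (metis add_eq_add_decompose)
  then have "joinable (rewrite_step R) y z"
    using joinable_add[OF assms(1)[OF lr], of w] yz by (simp add: add.assoc)
  then show ?thesis
    by (simp add: joinable_def)
qed


section \<open>Weights and the curve ideal\<close>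

text \<open>The exponent of t in the image of the monomial under the curve homomorphism.\<close>

definition weight :: "(4 \<Rightarrow> nat) \<Rightarrow> (4 \<Rightarrow>\<^sub>0 nat) \<Rightarrow> nat" where
  "weight n m = (\<Sum>i\<in>UNIV. n i * Poly_Mapping.lookup m i)"

lemma weight_add: "weight n (x + y) = weight n x + weight n y"
  by (simp add: weight_def lookup_add distrib_left sum.distrib)

lemma total_degree_add: "total_degree (x + y) = total_degree x + total_degree y"
  by (simp add: total_degree_def lookup_add sum.distrib)

text \<open>Bounds the degree within a weight class, which makes degree-raising rewriting
  terminate.\<close>

lemma total_degree_le_weight:
  assumes "\<And>i. 0 < n i"
  shows "total_degree m \<le> weight n m"
  unfolding total_degree_def weight_def
  by (rule sum_mono) (use assms in \<open>simp add: Suc_leI\<close>)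

lemma lookup_le_total_degree: "Poly_Mapping.lookup m i \<le> total_degree m"
  unfolding total_degree_def by (rule member_le_sum) auto

text \<open>A monomial of weight w is sent to t^w, so the coefficient of t^w collects exactly the
  monomials of that weight.\<close>

lemma coeff_curve_hom:
  "Polynomial.coeff (curve_hom n f) w = coeff_sum (\<lambda>m. weight n m = w) f"
proof -
  have "(\<Prod>i\<in>A. Polynomial.monom (1::'a) (n i) ^ Poly_Mapping.lookup m i) =
      Polynomial.monom 1 (\<Sum>i\<in>A. n i * Poly_Mapping.lookup m i)" for A :: "4 set" and m
    by (induction A rule: infinite_finite_induct) (simp_all add: monom_power mult_monom)
  then have "Polynomial.coeff (curve_hom n f) w =
      (\<Sum>m\<in>Poly_Mapping.keys f. if weight n m = w then Poly_Mapping.lookup f m else 0)"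
    unfolding curve_hom_def weight_def coeff_sum
    by (intro sum.cong) auto
  then show ?thesis
    by (simp add: coeff_sum_def sum.inter_filter)
qed

lemma curve_ideal_iff:
  "f \<in> curve_ideal n \<longleftrightarrow> (\<forall>w. coeff_sum (\<lambda>m. weight n m = w) f = 0)"
  by (simp add: curve_ideal_def a_kernel_def' ring_of_type_algebra_def poly_eq_iff coeff_curve_hom)

lemma binomial_mem_curve_ideal_iff:
  "Poly_Mapping.single x (1::'k::field) - Poly_Mapping.single y 1 \<in> curve_ideal n \<longleftrightarrow>
    weight n x = weight n y"
  by (auto simp: curve_ideal_iff coeff_sum_diff coeff_sum_single)


section \<open>Initial forms\<close>

lemma single_one_eq_iff: "Poly_Mapping.single x (1::'a::zero_neq_one) = Poly_Mapping.single y 1 \<longleftrightarrow> x = y"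
  by (metis lookup_single_eq lookup_single_not_eq zero_neq_one)

lemma initial_form_binomial_less:
  assumes "total_degree x < total_degree y"
  shows "initial_form (Poly_Mapping.single x (1::'k::field) - Poly_Mapping.single y 1) = Poly_Mapping.single x 1"
proof -
  let ?f = "Poly_Mapping.single x (1::'k) - Poly_Mapping.single y 1"
  have ne: "x \<noteq> y" using assms by auto
  have keys: "Poly_Mapping.keys ?f = {x, y}"
    using ne by (auto simp: in_keys_iff lookup_minus lookup_single when_def split: if_splits)
  have "{m \<in> {x, y}. total_degree m = total_degree x} = {x}"
    using assms by auto
  then have x: "homogeneous_summand (total_degree x) ?f = Poly_Mapping.single x 1"
    using ne by (simp add: homogeneous_summand_def keys lookup_minus lookup_single)
  have "homogeneous_summand d ?f = 0" if "d < total_degree x" for d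
  proof -
    have "{m \<in> {x, y}. total_degree m = d} = {}" using that assms by auto
    then show ?thesis by (simp only: homogeneous_summand_def keys sum.empty)
  qed
  moreover have "Poly_Mapping.single x (1::'k) \<noteq> 0"
    by (metis lookup_single_eq lookup_zero zero_neq_one)
  ultimately have "(LEAST d. homogeneous_summand d ?f \<noteq> 0) = total_degree x"
    by (intro Least_equality) (use x in \<open>auto simp: not_less[symmetric]\<close>)
  then show ?thesis
    by (simp add: initial_form_def x)
qed

lemma initial_form_binomial_eq:
  assumes "total_degree x = total_degree y" "x \<noteq> y"
  shows "initial_form (Poly_Mapping.single x (1::'k::field) - Poly_Mapping.single y 1) =
    Poly_Mapping.single x 1 - Poly_Mapping.single y 1"
proof -
  let ?f = "Poly_Mapping.single x (1::'k) - Poly_Mapping.single y 1"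
  have keys: "Poly_Mapping.keys ?f = {x, y}"
    using assms(2) by (auto simp: in_keys_iff lookup_minus lookup_single when_def split: if_splits)
  have "{m \<in> {x, y}. total_degree m = total_degree x} = {x, y}"
    using assms by auto
  then have x: "homogeneous_summand (total_degree x) ?f = ?f"
    using poly_mapping_sum_single[of ?f] by (simp only: homogeneous_summand_def keys)
  have "homogeneous_summand d ?f = 0" if "d < total_degree x" for d
  proof -
    have "{m \<in> {x, y}. total_degree m = d} = {}" using that assms by auto
    then show ?thesis by (simp only: homogeneous_summand_def keys sum.empty)
  qed
  moreover have "?f \<noteq> 0"
    using keys by fastforce
  ultimately have "(LEAST d. homogeneous_summand d ?f \<noteq> 0) = total_degree x"
    by (intro Least_equality) (auto simp: x not_less[symmetric])
  then show ?thesis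
    by (simp add: initial_form_def x)
qed

lemma initial_form_mem_initial_ideal: "f \<in> I \<Longrightarrow> f \<noteq> 0 \<Longrightarrow> initial_form f \<in> initial_ideal I"
  unfolding initial_ideal_def by (rule subsetD[OF ideal_of_superset]) blast

lemma single_mem_initial_ideal:
  assumes "weight n x = weight n y" "total_degree x < total_degree y"
  shows "Poly_Mapping.single x (1::'k::field) \<in> initial_ideal (curve_ideal n)"
  using initial_form_mem_initial_ideal[of "Poly_Mapping.single x (1::'k) - Poly_Mapping.single y 1" "curve_ideal n"]
    assms by (auto simp: binomial_mem_curve_ideal_iff initial_form_binomial_less single_one_eq_iff)

lemma binomial_mem_initial_ideal:
  assumes "weight n x = weight n y" "total_degree x = total_degree y"
  shows "Poly_Mapping.single x (1::'k::field) - Poly_Mapping.single y 1 \<in> initial_ideal (curve_ideal n)"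
proof (cases "x = y")
  case True
  then show ?thesis by (simp add: initial_ideal_def ideal_of_zero)
next
  case False
  then show ?thesis
    using initial_form_mem_initial_ideal[of "Poly_Mapping.single x (1::'k) - Poly_Mapping.single y 1" "curve_ideal n"]
      assms by (auto simp: binomial_mem_curve_ideal_iff initial_form_binomial_eq single_one_eq_iff)
qed


section \<open>Confluent rewriting systems and standard bases\<close>

text \<open>\<open>P\<close> plays the role of the initial forms of the rules \<open>R\<close>, and \<open>F\<close> that of the generators of the
  curve ideal.\<close>

locale standard_rewriting =
  fixes n :: "4 \<Rightarrow> nat"
    and R :: "((4 \<Rightarrow>\<^sub>0 nat) \<times> (4 \<Rightarrow>\<^sub>0 nat)) set"
    and P F :: "'k::field mpoly4 set"
  assumes n_pos: "0 < n i"
    and weight_rule: "(l, r) \<in> R \<Longrightarrow> weight n l = weight n r"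
    and rule_cases: "(l, r) \<in> R \<Longrightarrow>
        total_degree l < total_degree r \<and> Poly_Mapping.single l 1 \<in> ideal_of P \<or>
        total_degree l = total_degree r \<and> Poly_Mapping.lookup l 1 < Poly_Mapping.lookup r 1 \<and>
          Poly_Mapping.single l 1 - Poly_Mapping.single r 1 \<in> ideal_of P"
    and critical_pairs: "(l, r) \<in> R \<Longrightarrow> (l', r') \<in> R \<Longrightarrow>
        joinable (rewrite_step R) (r + (l' - l)) (r' + (l - l'))"
    and curve_ideal: "curve_ideal n = ideal_of F"
    and joinable_generators: "f \<in> F \<Longrightarrow>
        \<exists>x y. f = Poly_Mapping.single x 1 - Poly_Mapping.single y 1 \<and> joinable (rewrite_step R) x y"
begin

abbreviation S where "S \<equiv> rewrite_step R"

lemma weight_step: "(x, y) \<in> S \<Longrightarrow> weight n x = weight n y"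
  by (auto simp: rewrite_step_def weight_add weight_rule)

text \<open>A cofactor \<open>u\<close> adds the same amount to both degrees and to both exponents
  of x_1, and multiplication by it stays in the ideal, so the alternatives for rules pass to
  steps.\<close>

lemma step_cases: "(x, y) \<in> S \<Longrightarrow>
    total_degree x < total_degree y \<and> Poly_Mapping.single x 1 \<in> ideal_of P \<or>
    total_degree x = total_degree y \<and> Poly_Mapping.lookup x 1 < Poly_Mapping.lookup y 1 \<and>
      Poly_Mapping.single x 1 - Poly_Mapping.single y 1 \<in> ideal_of P"
proof -
  assume "(x, y) \<in> S"
  then obtain l r u where "(l, r) \<in> R" "x = l + u" "y = r + u"
    by (auto simp: rewrite_step_def)
  moreover have "Poly_Mapping.single (l + u) 1 \<in> ideal_of P" if "Poly_Mapping.single l 1 \<in> ideal_of P"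
    using ideal_of_mult[OF that, of "Poly_Mapping.single u 1"] by (simp add: mult_single add.commute)
  moreover have "Poly_Mapping.single (l + u) 1 - Poly_Mapping.single (r + u) 1 \<in> ideal_of P"
    if "Poly_Mapping.single l 1 - Poly_Mapping.single r 1 \<in> ideal_of P"
    using ideal_of_mult[OF that, of "Poly_Mapping.single u 1"]
    by (simp add: mult_single right_diff_distrib add.commute)
  ultimately show ?thesis
    using rule_cases[of l r] by (auto simp: total_degree_add lookup_add)
qed

text \<open>The weight is constant along a step and bounds both the degree and the exponent of x_1.
  Hence weight minus degree falls or, if the degrees agree, weight minus exponent of x_1
  falls.\<close>

lemma wf_step: "wf (S\<inverse>)"
proof (rule wf_subset)
  let ?f = "\<lambda>m. (weight n m - total_degree m, weight n m - Poly_Mapping.lookup m 1)"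
  show "wf (inv_image (less_than <*lex*> less_than) ?f)"
    by auto
  have "(?f y, ?f x) \<in> less_than <*lex*> less_than" if "(x, y) \<in> S" for x y
  proof -
    have "total_degree y \<le> weight n y"
      by (rule total_degree_le_weight) (rule n_pos)
    then show ?thesis
      using weight_step[OF that] step_cases[OF that] lookup_le_total_degree[of y 1] by auto
  qed
  then show "S\<inverse> \<subseteq> inv_image (less_than <*lex*> less_than) ?f"
    by (auto simp: inv_image_def)
qed

lemma confluent:
  "(x, y) \<in> S\<^sup>* \<Longrightarrow> (x, z) \<in> S\<^sup>* \<Longrightarrow> \<exists>v. (y, v) \<in> S\<^sup>* \<and> (z, v) \<in> S\<^sup>*"
  by (rule newman[OF wf_step rewrite_step_locally_confluent]) (rule critical_pairs)

text \<open>Confluence closes the peak at the middle monomial \<open>y\<close>.\<close>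

lemma joinable_trans: "joinable S x y \<Longrightarrow> joinable S y z \<Longrightarrow> joinable S x z"
  unfolding joinable_def by (meson confluent rtrancl_trans)

text \<open>The coefficient sum over the joinability class of \<open>x\<close> vanishes on monomial
  multiples of generators, whose two terms lie in the same class. So it vanishes on the binomial of
  \<open>x\<close> and \<open>y\<close>; as \<open>x\<close> contributes 1, \<open>y\<close> must be
  in the class too.\<close>

lemma joinable_of_weight_eq:
  assumes "weight n x = weight n y"
  shows "joinable S x y"
proof -
  let ?f = "Poly_Mapping.single x (1::'k) - Poly_Mapping.single y 1"
  have "?f \<in> ideal_of F"
    using assms by (simp flip: curve_ideal add: binomial_mem_curve_ideal_iff)
  then have "coeff_sum (joinable S x) ?f = 0"
  proof (rule coeff_sum_ideal_of)
    fix g u c assume "g \<in> F"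
    then obtain a b where g: "g = Poly_Mapping.single a 1 - Poly_Mapping.single b 1" "joinable S a b"
      using joinable_generators by blast
    have "joinable S (u + a) (u + b)"
      using joinable_add[OF g(2), of u] by (simp add: add.commute)
    then have "joinable S x (u + a) \<longleftrightarrow> joinable S x (u + b)"
      using joinable_trans[of x "u + a" "u + b"] joinable_trans[of x "u + b" "u + a"]
        joinable_sym[of S "u + a" "u + b"] by blast
    then show "coeff_sum (joinable S x) (Poly_Mapping.single u c * g) = 0"
      by (simp add: g(1) right_diff_distrib mult_single coeff_sum_diff coeff_sum_single)
  qed
  then show ?thesis
    by (simp add: coeff_sum_diff coeff_sum_single joinable_refl split: if_splits)
qed

section \<open>Normal forms and the initial forms of the curve ideal\<close>

definition nf where "nf m = (SOME s. (m, s) \<in> S\<^sup>* \<and> s \<notin> Domain S)"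

lemma nf: "(m, nf m) \<in> S\<^sup>*" "nf m \<notin> Domain S"
  using someI_ex[OF ex_normal_form[OF wf_step, of m]] by (auto simp: nf_def)

text \<open>The two normal forms are joinable and irreducible, so both equal their common
  reduct.\<close>

lemma nf_eq_of_weight_eq:
  assumes "weight n x = weight n y"
  shows "nf x = nf y"
proof -
  have "joinable S (nf x) x" "joinable S y (nf y)"
    using nf by (auto simp: joinable_def)
  then have "joinable S (nf x) (nf y)"
    using joinable_of_weight_eq[OF assms] joinable_trans by blast
  then obtain z where "(nf x, z) \<in> S\<^sup>*" "(nf y, z) \<in> S\<^sup>*"
    by (auto simp: joinable_def)
  then show ?thesis
    using nf(2) by (metis DomainI converse_rtranclE)
qed

text \<open>The degree never drops along a chain. Where it first rises, the current monomial lies in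
  the ideal, and the binomials of the preceding degree-preserving steps carry this back to
  \<open>x\<close>.\<close>

lemma steps_cases:
  "(x, y) \<in> S\<^sup>* \<Longrightarrow> total_degree x < total_degree y \<and> Poly_Mapping.single x 1 \<in> ideal_of P \<or>
    total_degree x = total_degree y \<and> Poly_Mapping.single x 1 - Poly_Mapping.single y 1 \<in> ideal_of P"
proof (induction rule: converse_rtrancl_induct)
  case base
  then show ?case by (simp add: ideal_of_zero)
next
  case (step x z)
  let ?s = "\<lambda>m. Poly_Mapping.single m (1::'k)"
  have "?s x \<in> ideal_of P" if "?s x - ?s z \<in> ideal_of P" "?s z \<in> ideal_of P"
    using ideal_of_add[OF that] by simp
  moreover have "?s x - ?s y \<in> ideal_of P" if "?s x - ?s z \<in> ideal_of P" "?s z - ?s y \<in> ideal_of P"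
    using ideal_of_add[OF that] by simp
  ultimately show ?case
    using step_cases[OF step(1)] step.IH by auto
qed

lemma smult_mem:
  assumes "Poly_Mapping.single x 1 \<in> ideal_of P"
  shows "Poly_Mapping.single x c \<in> ideal_of P"
  using ideal_of_mult[OF assms, of "Poly_Mapping.single 0 c"] by (simp add: mult_single)

lemma smult_diff_mem:
  assumes "Poly_Mapping.single x 1 - Poly_Mapping.single y 1 \<in> ideal_of P"
  shows "Poly_Mapping.single x c - Poly_Mapping.single y c \<in> ideal_of P"
  using ideal_of_mult[OF assms, of "Poly_Mapping.single 0 c"] by (simp add: mult_single right_diff_distrib)

text \<open>Split the terms of the initial form by whether passing to the normal form raises the
  degree. Those outside \<open>E\<close> are in the ideal one by one; those in \<open>E\<close> may
  be replaced by their normal forms modulo the ideal, and the normal forms cancel within each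
  weight.\<close>

lemma initial_form_mem:
  assumes f: "f \<in> curve_ideal n" "f \<noteq> 0"
  shows "initial_form f \<in> ideal_of P"
proof -
  let ?c = "Poly_Mapping.lookup f"
  define d where "d = (LEAST d. homogeneous_summand d f \<noteq> 0)"
  define D where "D = {m \<in> Poly_Mapping.keys f. total_degree m = d}"
  define E where "E = {m \<in> D. total_degree (nf m) = d}"
  have [simp]: "finite D" "finite E"
    by (simp_all add: D_def E_def)
  have deg_ge: "d \<le> total_degree m" if m: "m \<in> Poly_Mapping.keys f" for m
  proof -
    have "Poly_Mapping.lookup (homogeneous_summand (total_degree m) f) m = ?c m"
      using m by (simp add: homogeneous_summand_def lookup_sum lookup_single when_def)
    then have "homogeneous_summand (total_degree m) f \<noteq> 0"
      using m by (auto simp: in_keys_iff)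
    then show ?thesis
      unfolding d_def by (rule Least_le)
  qed
  have "initial_form f = (\<Sum>m\<in>D. Poly_Mapping.single m (?c m))"
    unfolding initial_form_def d_def[symmetric] by (simp add: homogeneous_summand_def D_def)
  also have "\<dots> = (\<Sum>m\<in>D - E. Poly_Mapping.single m (?c m)) + (\<Sum>m\<in>E. Poly_Mapping.single m (?c m))"
    by (rule sum.subset_diff) (auto simp: E_def)
  also have "(\<Sum>m\<in>E. Poly_Mapping.single m (?c m)) =
      (\<Sum>m\<in>E. Poly_Mapping.single m (?c m) - Poly_Mapping.single (nf m) (?c m)) +
      (\<Sum>m\<in>E. Poly_Mapping.single (nf m) (?c m))"
    by (simp add: sum_subtractf)
  also have "(\<Sum>m\<in>E. Poly_Mapping.single (nf m) (?c m)) = 0"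
  proof -
    have "(\<Sum>m\<in>E. Poly_Mapping.single (nf m) (?c m)) =
        (\<Sum>w\<in>weight n ` E. \<Sum>m | m \<in> E \<and> weight n m = w. Poly_Mapping.single (nf m) (?c m))"
      by (rule sum.image_gen) simp
    also have "\<dots> = 0"
    proof (rule sum.neutral, rule ballI)
      fix w assume "w \<in> weight n ` E"
      then obtain a where a: "a \<in> E" "weight n a = w"
        by blast
      \<comment> \<open>A weight class that meets \<open>E\<close> has all its terms of
        \<open>f\<close> in \<open>E\<close>: they share a normal form of degree \<open>d\<close>,
        which bounds their degrees from above, while \<open>d\<close> is the least degree in
        \<open>f\<close>. So the kernel condition for the whole class applies to the sum over
        \<open>E\<close>.\<close>
      have "{m \<in> E. weight n m = w} = {m \<in> Poly_Mapping.keys f. weight n m = w}"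
      proof (intro equalityI subsetI)
        fix m assume "m \<in> {m \<in> Poly_Mapping.keys f. weight n m = w}"
        then have m: "m \<in> Poly_Mapping.keys f" "weight n m = w" by auto
        have "nf m = nf a"
          using m a by (intro nf_eq_of_weight_eq) simp
        moreover have "total_degree m \<le> total_degree (nf m)"
          using steps_cases[OF nf(1), of m] by auto
        ultimately have "total_degree m = d \<and> total_degree (nf m) = d"
          using a deg_ge[OF m(1)] by (auto simp: E_def)
        then show "m \<in> {m \<in> E. weight n m = w}"
          using m by (auto simp: E_def D_def)
      qed (auto simp: E_def D_def)
      moreover have "coeff_sum (\<lambda>m. weight n m = w) f = 0"
        using f(1) by (simp add: curve_ideal_iff)
      ultimately have "(\<Sum>m | m \<in> E \<and> weight n m = w. ?c m) = 0"
        by (simp add: coeff_sum_def)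
      moreover have "(\<Sum>m | m \<in> E \<and> weight n m = w. Poly_Mapping.single (nf m) (?c m)) =
          (\<Sum>m | m \<in> E \<and> weight n m = w. Poly_Mapping.single (nf a) (?c m))"
      proof (rule sum.cong)
        fix m assume "m \<in> {m \<in> E. weight n m = w}"
        then have "nf m = nf a"
          using a by (intro nf_eq_of_weight_eq) simp
        then show "Poly_Mapping.single (nf m) (?c m) = Poly_Mapping.single (nf a) (?c m)"
          by simp
      qed simp
      moreover have "(\<Sum>m\<in>B. Poly_Mapping.single (nf a) (?c m)) = Poly_Mapping.single (nf a) (\<Sum>m\<in>B. ?c m)" for B
        by (induction B rule: infinite_finite_induct) (simp_all add: single_add)
      ultimately show "(\<Sum>m | m \<in> E \<and> weight n m = w. Poly_Mapping.single (nf m) (?c m)) = 0"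
        by simp
    qed
    finally show ?thesis .
  qed
  finally have "initial_form f = (\<Sum>m\<in>D - E. Poly_Mapping.single m (?c m)) +
      (\<Sum>m\<in>E. Poly_Mapping.single m (?c m) - Poly_Mapping.single (nf m) (?c m))"
    by simp
  moreover have "Poly_Mapping.single m (?c m) \<in> ideal_of P" if "m \<in> D - E" for m
  proof (rule smult_mem)
    show "Poly_Mapping.single m 1 \<in> ideal_of P"
      using that steps_cases[OF nf(1), of m] by (auto simp: D_def E_def)
  qed
  moreover have "Poly_Mapping.single m (?c m) - Poly_Mapping.single (nf m) (?c m) \<in> ideal_of P"
    if "m \<in> E" for m
  proof (rule smult_diff_mem)
    show "Poly_Mapping.single m 1 - Poly_Mapping.single (nf m) 1 \<in> ideal_of P"
      using that steps_cases[OF nf(1), of m] by (auto simp: D_def E_def)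
  qed
  ultimately show ?thesis
    by (auto intro!: ideal_of_add ideal_of_sum)
qed

lemma initial_ideal_subset: "initial_ideal (curve_ideal n) \<subseteq> ideal_of P"
  unfolding initial_ideal_def
  by (rule ideal_of_subset_ideal_of) (use initial_form_mem in blast)

end


section \<open>Monomials in four variables\<close>

definition mk :: "nat \<Rightarrow> nat \<Rightarrow> nat \<Rightarrow> nat \<Rightarrow> (4 \<Rightarrow>\<^sub>0 nat)" where
  "mk a b c d = Poly_Mapping.single 1 a + Poly_Mapping.single 2 b + Poly_Mapping.single 3 c + Poly_Mapping.single 4 d"

text \<open>Four pairwise distinct numerals exhaust a type of cardinality four.\<close>

lemma UNIV_4: "(UNIV :: 4 set) = {1, 2, 3, 4}"
  by (rule card_subset_eq[symmetric]) simp_all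

lemma sum_4: "(\<Sum>i\<in>UNIV. f (i :: 4)) = f 1 + f 2 + f 3 + (f 4 :: 'a::comm_monoid_add)"
  by (subst UNIV_4) (simp add: add.assoc)

lemma lookup_mk [simp]:
  "Poly_Mapping.lookup (mk a b c d) 1 = a" "Poly_Mapping.lookup (mk a b c d) 2 = b"
  "Poly_Mapping.lookup (mk a b c d) 3 = c" "Poly_Mapping.lookup (mk a b c d) 4 = d"
  by (simp_all add: mk_def lookup_add lookup_single)

lemma eq_mk_iff: "m = mk a b c d \<longleftrightarrow> Poly_Mapping.lookup m 1 = a \<and> Poly_Mapping.lookup m 2 = b \<and>
    Poly_Mapping.lookup m 3 = c \<and> Poly_Mapping.lookup m 4 = d"
proof -
  have "i = 1 \<or> i = 2 \<or> i = 3 \<or> i = 4" for i :: 4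
    using UNIV_4 by blast
  then show ?thesis
    by (auto intro!: poly_mapping_eqI) (metis lookup_mk)
qed

lemma mk_eq_iff [simp]: "mk a b c d = mk a' b' c' d' \<longleftrightarrow> a = a' \<and> b = b' \<and> c = c' \<and> d = d'"
  by (simp add: eq_mk_iff)

lemma mk_add [simp]: "mk a b c d + mk a' b' c' d' = mk (a + a') (b + b') (c + c') (d + d')"
  by (simp add: eq_mk_iff lookup_add)

lemma mk_diff [simp]: "mk a b c d - mk a' b' c' d' = mk (a - a') (b - b') (c - c') (d - d')"
  by (simp add: eq_mk_iff lookup_minus)

lemma mk_eq_mk_add: "mk a b c d = mk a' b' c' d' + u \<Longrightarrow> a' \<le> a \<and> b' \<le> b \<and> c' \<le> c \<and> d' \<le> d"
  by (metis le_add1 lookup_add lookup_mk)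

lemma total_degree_mk [simp]: "total_degree (mk a b c d) = a + b + c + d"
  by (simp only: total_degree_def sum_4 lookup_mk)

lemma weight_mk [simp]: "weight n (mk a b c d) = a * n 1 + b * n 2 + c * n 3 + d * n 4"
  by (simp only: weight_def sum_4 lookup_mk mult.commute)

lemma Var_power: "Var i ^ k = Poly_Mapping.single (Poly_Mapping.single i k) 1"
  by (induction k) (simp_all add: Var_def mult_single flip: single_add)

lemma Var_power_mk:
  "Var 1 ^ k = Poly_Mapping.single (mk k 0 0 0) 1" "Var 2 ^ k = Poly_Mapping.single (mk 0 k 0 0) 1"
  "Var 3 ^ k = Poly_Mapping.single (mk 0 0 k 0) 1" "Var 4 ^ k = Poly_Mapping.single (mk 0 0 0 k) 1"
  by (simp_all add: Var_power mk_def)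


section \<open>The rewriting system of a Gorenstein monomial curve\<close>

text \<open>A pure power of the lightest variable needs the larger exponent. Applied to the weight
  relations of f_1 and f_2.\<close>

lemma weight_eq_imp_less:
  fixes a b c x y z :: nat
  assumes "a * x = b * y + c * z" "x < y" "x < z" "0 < b"
  shows "b + c < a"
proof -
  have "b * x < b * y" "c * x \<le> c * z"
    using assms by simp_all
  then have "(b + c) * x < a * x"
    unfolding assms(1) distrib_right by linarith
  then show ?thesis by simp
qed

text \<open>The mirror image for a pure power of the heaviest variable, applied to the relations of
  f_3 and f_4.\<close>

lemma weight_eq_imp_greater:
  fixes a b c x y z :: nat
  assumes "a * x = b * y + c * z" "y < x" "z < x" "0 < b"
  shows "a < b + c"
proof -
  have "b * y < b * x" "c * z \<le> c * x"
    using assms by simp_all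
  then have "a * x < (b + c) * x"
    unfolding assms(1) distrib_right by linarith
  then show ?thesis by simp
qed

text \<open>The monomial \<open>x\<^sub>1\<^sup>A x\<^sub>3\<^sup>C x\<^sub>4\<^sup>D\<close> is the second term of the sixth standard basis element, which depends
  on the comparison of \<open>a24\<close> and \<open>a14\<close>.\<close>

locale gorenstein_exponents =
  fixes a1 a2 a3 a4 a12 a14 a23 a24 a31 a32 a41 a43 A C D :: nat
  assumes pos: "0 < a12" "0 < a14" "0 < a23" "0 < a24" "0 < a31" "0 < a32" "0 < a41" "0 < a43"
    and a1: "a1 = a31 + a41" and a2: "a2 = a12 + a32" and a3: "a3 = a23 + a43" and a4: "a4 = a14 + a24"
    and a43_le: "a43 \<le> a23"
    and tail6: "a24 < a14 \<and> A = a31 \<and> C = a23 - a43 \<and> D = 2 * a24 \<or>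
      a14 \<le> a24 \<and> A = a1 \<and> C = a23 \<and> D = a24 - a14"
begin

text \<open>The left sides are the leading monomials of the six claimed generators, in the same
  order. All of them are free of x_1, which later decides ties and minimality.\<close>

definition rules :: "((4 \<Rightarrow>\<^sub>0 nat) \<times> (4 \<Rightarrow>\<^sub>0 nat)) list" where
  "rules =
    [(mk 0 a12 0 a14, mk a1 0 0 0),
     (mk 0 0 a23 a24, mk 0 a2 0 0),
     (mk 0 0 a3 0, mk a31 a32 0 0),
     (mk 0 0 0 a4, mk a41 0 a43 0),
     (mk 0 a12 a43 0, mk a31 0 0 a24),
     (mk 0 (a2 + a12) 0 0, mk A 0 C D)]"

abbreviation S where "S \<equiv> rewrite_step (set rules)"

text \<open>Each rule with an explicit cofactor \<open>mk p q r s\<close>, placed in the reflexive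
  transitive closure so that several of them chain.\<close>

lemma
  shows step1: "(mk p (a12 + q) r (a14 + s), mk (a1 + p) q r s) \<in> S\<^sup>*"
    and step2: "(mk p q (a23 + r) (a24 + s), mk p (a2 + q) r s) \<in> S\<^sup>*"
    and step3: "(mk p q (a3 + r) s, mk (a31 + p) (a32 + q) r s) \<in> S\<^sup>*"
    and step4: "(mk p q r (a4 + s), mk (a41 + p) q (a43 + r) s) \<in> S\<^sup>*"
    and step5: "(mk p (a12 + q) (a43 + r) s, mk (a31 + p) q r (a24 + s)) \<in> S\<^sup>*"
    and step6: "(mk p (a2 + a12 + q) r s, mk (A + p) q (C + r) (D + s)) \<in> S\<^sup>*"
  using rewrite_stepI[where R = "set rules" and u = "mk p q r s"]
  by (fastforce simp: rules_def)+

lemma joinableI: "(x, z) \<in> S\<^sup>* \<Longrightarrow> (y, z) \<in> S\<^sup>* \<Longrightarrow> joinable S x y"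
  by (auto simp: joinable_def)

section \<open>Critical pairs of rules whose left sides share a variable\<close>

lemma pair12: "joinable S (mk a1 0 a23 (a24 - a14)) (mk 0 (a2 + a12) 0 (a14 - a24))"
  using tail6
proof
  assume *: "a24 < a14 \<and> A = a31 \<and> C = a23 - a43 \<and> D = 2 * a24"
  \<comment> \<open>The tail of rule 6 has x_4-exponent \<open>2 * a24\<close>; with the cofactor
    this becomes exactly \<open>a4\<close>, so that rule 4 applies next.\<close>
  have "(mk 0 (a2 + a12) 0 (a14 - a24), mk a31 0 (a23 - a43) a4) \<in> S\<^sup>*"
    using step6[of 0 0 0 "a14 - a24"] * by (simp add: a4 add.commute mult_2)
  moreover have "(mk a31 0 (a23 - a43) a4, mk a1 0 a23 (a24 - a14)) \<in> S\<^sup>*"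
    using step4[of a31 0 "a23 - a43" 0] * a43_le by (simp add: a1 add.commute)
  ultimately show ?thesis
    by (rule joinableI[OF rtrancl_refl rtrancl_trans])
next
  assume "a14 \<le> a24 \<and> A = a1 \<and> C = a23 \<and> D = a24 - a14"
  then show ?thesis
    using step6[of 0 0 0 0] by (intro joinableI[OF rtrancl_refl]) simp
qed

lemma pair14: "joinable S (mk a1 0 0 a24) (mk a41 a12 a43 0)"
  using step5[of a41 0 0 0] by (intro joinableI[OF rtrancl_refl]) (simp add: a1 add.commute)

lemma pair15: "joinable S (mk a1 0 a43 0) (mk a31 0 0 (a24 + a14))"
  using step4[of a31 0 0 0] by (intro joinableI[OF rtrancl_refl]) (simp add: a1 a4 add.commute)

lemma pair16: "joinable S (mk a1 a2 0 0) (mk A 0 C (D + a14))"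
  using tail6
proof
  assume *: "a24 < a14 \<and> A = a31 \<and> C = a23 - a43 \<and> D = 2 * a24"
  have "(mk A 0 C (D + a14), mk a1 0 a23 a24) \<in> S\<^sup>*"
    using step4[of a31 0 "a23 - a43" a24] * a43_le by (simp add: a1 a4 add.commute mult_2 add.left_commute)
  moreover have "(mk a1 0 a23 a24, mk a1 a2 0 0) \<in> S\<^sup>*"
    using step2[of a1 0 0 0] by simp
  ultimately show ?thesis
    by (rule joinableI[OF rtrancl_refl rtrancl_trans])
next
  assume "a14 \<le> a24 \<and> A = a1 \<and> C = a23 \<and> D = a24 - a14"
  then show ?thesis
    using step2[of a1 0 0 0] by (intro joinableI[OF rtrancl_refl]) simp
qed

lemma pair23: "joinable S (mk 0 a2 a43 0) (mk a31 a32 0 a24)"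
  using step5[of 0 a32 0 0] by (intro joinableI[OF _ rtrancl_refl]) (simp add: a2 add.commute)

lemma pair24: "joinable S (mk 0 a2 0 a14) (mk a41 0 (a43 + a23) 0)"
  using step1[of 0 a32 0 0] step3[of a41 0 0 0] by (intro joinableI) (simp_all add: a1 a2 a3 add.commute)

text \<open>The origin of the sixth rule. If \<open>a24 < a14\<close>, the second monomial is
  already its tail; otherwise \<open>a4 \<le> 2 * a24\<close>, and one application of rule 4 turns
  it into the tail.\<close>

lemma pair25: "joinable S (mk 0 (a2 + a12) 0 0) (mk a31 0 (a23 - a43) (a24 + a24))"
  using tail6
proof
  assume "a24 < a14 \<and> A = a31 \<and> C = a23 - a43 \<and> D = 2 * a24"
  then show ?thesis
    using step6[of 0 0 0 0] by (intro joinableI[OF _ rtrancl_refl]) (simp add: mult_2)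
next
  assume *: "a14 \<le> a24 \<and> A = a1 \<and> C = a23 \<and> D = a24 - a14"
  have "a4 + (a24 - a14) = a24 + a24" using * by (simp add: a4)
  then have "(mk a31 0 (a23 - a43) (a24 + a24), mk A 0 C D) \<in> S\<^sup>*"
    using step4[of a31 0 "a23 - a43" "a24 - a14"] * a43_le by (simp add: a1 add.commute)
  then show ?thesis
    using step6[of 0 0 0 0] by (intro joinableI) simp_all
qed

lemma pair35: "joinable S (mk a31 (a32 + a12) 0 0) (mk a31 0 a23 a24)"
  using step2[of a31 0 0 0] by (intro joinableI[OF rtrancl_refl]) (simp add: a2 add.commute)

lemma pair56: "joinable S (mk a31 a2 0 a24) (mk A 0 (C + a43) D)"
  using tail6
proof
  assume "a24 < a14 \<and> A = a31 \<and> C = a23 - a43 \<and> D = 2 * a24"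
  then show ?thesis
    using step2[of a31 0 0 a24] a43_le by (intro joinableI[OF rtrancl_refl]) (simp add: mult_2)
next
  assume *: "a14 \<le> a24 \<and> A = a1 \<and> C = a23 \<and> D = a24 - a14"
  have "(mk a31 a2 0 a24, mk (a1 + a31) a32 0 (a24 - a14)) \<in> S\<^sup>*"
    using step1[of a31 a32 0 "a24 - a14"] * by (simp add: a2)
  moreover have "(mk A 0 (C + a43) D, mk (a1 + a31) a32 0 (a24 - a14)) \<in> S\<^sup>*"
    using step3[of a1 0 0 "a24 - a14"] * by (simp add: a3 add.commute)
  ultimately show ?thesis
    by (rule joinableI)
qed

text \<open>Buchberger's product criterion: both monomials rewrite to the product of the right
  sides. For coprime left sides this is the critical pair.\<close>

lemma coprime_pair:
  assumes "(l, r) \<in> set rules" "(l', r') \<in> set rules"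
  shows "joinable S (r + l') (r' + l)"
  using rewrite_stepI[OF assms(1), of r'] rewrite_stepI[OF assms(2), of r]
  by (intro joinableI[of _ "r + r'"]) (auto simp: add.commute)

lemma critical_pairs:
  assumes "(l, r) \<in> set rules" "(l', r') \<in> set rules"
  shows "joinable S (r + (l' - l)) (r' + (l - l'))"
proof -
  have len: "length rules = 6"
    by (simp add: rules_def)
  then have mem: "rules ! i \<in> set rules" if "i < 6" for i
    using that by simp
  have nth: "rules ! 0 = (mk 0 a12 0 a14, mk a1 0 0 0)" "rules ! Suc 0 = (mk 0 0 a23 a24, mk 0 a2 0 0)"
    "rules ! 2 = (mk 0 0 a3 0, mk a31 a32 0 0)" "rules ! 3 = (mk 0 0 0 a4, mk a41 0 a43 0)"
    "rules ! 4 = (mk 0 a12 a43 0, mk a31 0 0 a24)" "rules ! 5 = (mk 0 (a2 + a12) 0 0, mk A 0 C D)"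
    by (simp_all add: rules_def)
  have diff: "a23 - a3 = 0" "a3 - a23 = a43" "a43 - a3 = 0" "a3 - a43 = a23" "a43 - a23 = 0"
    "a14 - a4 = 0" "a4 - a14 = a24" "a24 - a4 = 0" "a4 - a24 = a14"
    using a43_le by (simp_all add: a3 a4)
  have less: "joinable S (snd (rules ! i) + (fst (rules ! j) - fst (rules ! i)))
      (snd (rules ! j) + (fst (rules ! i) - fst (rules ! j)))" if "i < j" "j < 6" for i j
  proof -
    have "i = 0 \<or> i = 1 \<or> i = 2 \<or> i = 3 \<or> i = 4" "j = 1 \<or> j = 2 \<or> j = 3 \<or> j = 4 \<or> j = 5"
      using that by linarith+
    \<comment> \<open>Indices start at 0, so \<open>(i, j)\<close> is the pair of rules i+1 and j+1.
      The first line lists the nine pairs with a common variable, the second the six coprime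
      ones.\<close>
    then have "i = 0 \<and> j \<in> {1, 3, 4, 5} \<or> i = 1 \<and> j \<in> {2, 3, 4} \<or> (i, j) \<in> {(2, 4), (4, 5)} \<or>
      (i, j) \<in> {(0, 2), (1, 5), (2, 3), (2, 5), (3, 4), (3, 5)}"
      using \<open>i < j\<close> by (elim disjE) simp_all
    then consider "i = 0 \<and> j \<in> {1, 3, 4, 5} \<or> i = 1 \<and> j \<in> {2, 3, 4} \<or> (i, j) \<in> {(2, 4), (4, 5)}"
      | "(i, j) \<in> {(0, 2), (1, 5), (2, 3), (2, 5), (3, 4), (3, 5)}"
      by blast
    then show ?thesis
    proof cases
      case 1
      then show ?thesis
        using pair12 pair14 pair15 pair16 pair23 pair24 pair25 pair35 pair56
        by (elim disjE conjE insertE emptyE) (simp_all add: nth diff)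
    next
      case 2
      \<comment> \<open>Coprime left sides have disjoint supports, so truncated subtraction leaves
        them unchanged.\<close>
      then have "fst (rules ! j) - fst (rules ! i) = fst (rules ! j)"
          "fst (rules ! i) - fst (rules ! j) = fst (rules ! i)"
        by (auto simp: nth)
      then show ?thesis
        using coprime_pair[of "fst (rules ! i)" "snd (rules ! i)" "fst (rules ! j)" "snd (rules ! j)"]
          mem that by simp
    qed
  qed
  obtain i j where ij: "i < 6" "j < 6" "(l, r) = rules ! i" "(l', r') = rules ! j"
    using assms unfolding in_set_conv_nth len by metis
  consider "i < j" | "i = j" | "j < i" by linarith
  then show ?thesis
  proof cases
    case 1
    then show ?thesis using less[of i j] ij by (metis fst_conv snd_conv)
  next
    case 2
    then show ?thesis using ij by (metis joinable_refl prod.inject)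
  next
    case 3
    then show ?thesis using less[of j i] ij joinable_sym by (metis fst_conv snd_conv)
  qed
qed

end


section \<open>The initial ideal of the curve and its minimal generators\<close>

definition bresinsky_generators ::
    "nat \<Rightarrow> nat \<Rightarrow> nat \<Rightarrow> nat \<Rightarrow> nat \<Rightarrow> nat \<Rightarrow> nat \<Rightarrow> nat \<Rightarrow> nat \<Rightarrow> nat \<Rightarrow> nat \<Rightarrow> nat \<Rightarrow> 'k::field mpoly4 set" where
  "bresinsky_generators a1 a2 a3 a4 a12 a14 a23 a24 a31 a32 a41 a43 =
    {Poly_Mapping.single (mk a1 0 0 0) 1 - Poly_Mapping.single (mk 0 a12 0 a14) 1,
     Poly_Mapping.single (mk 0 a2 0 0) 1 - Poly_Mapping.single (mk 0 0 a23 a24) 1,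
     Poly_Mapping.single (mk 0 0 a3 0) 1 - Poly_Mapping.single (mk a31 a32 0 0) 1,
     Poly_Mapping.single (mk 0 0 0 a4) 1 - Poly_Mapping.single (mk a41 0 a43 0) 1,
     Poly_Mapping.single (mk a31 0 0 a24) 1 - Poly_Mapping.single (mk 0 a12 a43 0) 1}"

context gorenstein_exponents
begin

text \<open>One inclusion is the standard basis property of the confluent rules, the other holds
  because the listed polynomials are initial forms of binomials in the curve ideal. Minimality is
  read off from the left sides of the rules.\<close>

lemma minimally_generates_initial_ideal:
  fixes n :: "4 \<Rightarrow> nat" and p5 p6 :: "'k::field mpoly4"
  assumes n: "0 < n 1" "n 1 < n 2" "n 2 < n 3" "n 3 < n 4"
    and w1: "a1 * n 1 = a12 * n 2 + a14 * n 4" and w2: "a2 * n 2 = a23 * n 3 + a24 * n 4"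
    and w3: "a3 * n 3 = a31 * n 1 + a32 * n 2" and w4: "a4 * n 4 = a41 * n 1 + a43 * n 3"
    and w5: "a31 * n 1 + a24 * n 4 = a12 * n 2 + a43 * n 3"
    and curve: "curve_ideal n = ideal_of
        (bresinsky_generators a1 a2 a3 a4 a12 a14 a23 a24 a31 a32 a41 a43 :: 'k mpoly4 set)"
    and deg5: "a12 + a43 \<le> a31 + a24" and deg6: "a2 + a12 \<le> A + C + D"
    and p5_less: "a12 + a43 < a31 + a24 \<Longrightarrow> p5 = Poly_Mapping.single (mk 0 a12 a43 0) 1"
    and p5_eq: "a12 + a43 = a31 + a24 \<Longrightarrow>
      p5 = Poly_Mapping.single (mk a31 0 0 a24) 1 - Poly_Mapping.single (mk 0 a12 a43 0) 1"
    and p6_less: "a2 + a12 < A + C + D \<Longrightarrow> p6 = Poly_Mapping.single (mk 0 (a2 + a12) 0 0) 1"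
    and p6_eq: "a2 + a12 = A + C + D \<Longrightarrow>
      p6 = Poly_Mapping.single (mk 0 (a2 + a12) 0 0) 1 - Poly_Mapping.single (mk A 0 C D) 1"
  defines "ps \<equiv> [Poly_Mapping.single (mk 0 a12 0 a14) 1, Poly_Mapping.single (mk 0 0 a23 a24) 1,
    Poly_Mapping.single (mk 0 0 a3 0) 1, Poly_Mapping.single (mk 0 0 0 a4) 1, p5, p6]"
  shows "minimally_generates ps (initial_ideal (curve_ideal n))"
proof -
  \<comment> \<open>The sixth rule is a consequence of the second and fifth relations in the first
    case, and of the first and second in the other. The auxiliary \<open>e\<close> removes truncated
    subtraction.\<close>
  have w6: "(a2 + a12) * n 2 = A * n 1 + C * n 3 + D * n 4"
    using tail6
  proof
    assume *: "a24 < a14 \<and> A = a31 \<and> C = a23 - a43 \<and> D = 2 * a24"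
    obtain e where e: "a23 = a43 + e" using a43_le le_iff_add by blast
    show ?thesis
      using w2 w5 by (simp add: * e algebra_simps)
  next
    assume *: "a14 \<le> a24 \<and> A = a1 \<and> C = a23 \<and> D = a24 - a14"
    then obtain e where e: "a24 = a14 + e" using le_iff_add by blast
    show ?thesis
      using w1 w2 by (simp add: * e algebra_simps)
  qed
  have A_pos: "0 < A"
    using tail6 pos by (auto simp: a1)
  \<comment> \<open>The order of the \<open>n i\<close> directs the first four rules;
    \<open>deg5\<close> and \<open>deg6\<close> direct the last two.\<close>
  have degs: "a12 + a14 < a1" "a23 + a24 < a2" "a3 < a31 + a32" "a4 < a41 + a43"
    using weight_eq_imp_less[OF w1] weight_eq_imp_less[OF w2] weight_eq_imp_greater[OF w3]
      weight_eq_imp_greater[OF w4] n pos by auto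
  have n_pos: "0 < n i" for i
    using n UNIV_4 by (cases "i = 1 \<or> i = 2 \<or> i = 3 \<or> i = 4") auto
  note weights = w1 w2 w3 w4 w5 w6
  have rules_weight: "weight n l = weight n r" if "(l, r) \<in> set rules" for l r
    using that weights by (auto simp: rules_def)
  have in_ideal: "p \<in> ideal_of (set ps)" if "p \<in> set ps" for p
    using that ideal_of_superset by blast
  have p5_cases: "a12 + a43 < a31 + a24 \<and> p5 = Poly_Mapping.single (mk 0 a12 a43 0) 1 \<or>
      a12 + a43 = a31 + a24 \<and>
      p5 = Poly_Mapping.single (mk a31 0 0 a24) 1 - Poly_Mapping.single (mk 0 a12 a43 0) 1"
    using deg5 p5_less p5_eq by linarith
  have p6_cases: "a2 + a12 < A + C + D \<and> p6 = Poly_Mapping.single (mk 0 (a2 + a12) 0 0) 1 \<or>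
      a2 + a12 = A + C + D \<and>
      p6 = Poly_Mapping.single (mk 0 (a2 + a12) 0 0) 1 - Poly_Mapping.single (mk A 0 C D) 1"
    using deg6 p6_less p6_eq by linarith
  \<comment> \<open>Ties can occur for the last two rules only; there the exponent of x_1 rises from
    0 to \<open>a31\<close> or to \<open>A\<close>.\<close>
  have rule_cases: "total_degree l < total_degree r \<and> Poly_Mapping.single l 1 \<in> ideal_of (set ps) \<or>
      total_degree l = total_degree r \<and> Poly_Mapping.lookup l 1 < Poly_Mapping.lookup r 1 \<and>
      Poly_Mapping.single l 1 - Poly_Mapping.single r 1 \<in> ideal_of (set ps)"
    if "(l, r) \<in> set rules" for l r
  proof -
    have ps: "Poly_Mapping.single (mk 0 a12 0 a14) 1 \<in> ideal_of (set ps)"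
      "Poly_Mapping.single (mk 0 0 a23 a24) 1 \<in> ideal_of (set ps)"
      "Poly_Mapping.single (mk 0 0 a3 0) 1 \<in> ideal_of (set ps)"
      "Poly_Mapping.single (mk 0 0 0 a4) 1 \<in> ideal_of (set ps)"
      "p5 \<in> ideal_of (set ps)" "p6 \<in> ideal_of (set ps)"
      by (rule in_ideal, simp add: ps_def)+
    \<comment> \<open>In a tie \<open>p5\<close> has the sign opposite to the direction of rule
      5.\<close>
    have "- p5 \<in> ideal_of (set ps)"
      using ps(5) by (rule ideal_of_uminus)
    then have rule5: "a12 + a43 < a31 + a24 \<and> Poly_Mapping.single (mk 0 a12 a43 0) 1 \<in> ideal_of (set ps) \<or>
        a12 + a43 = a31 + a24 \<and>
        Poly_Mapping.single (mk 0 a12 a43 0) 1 - Poly_Mapping.single (mk a31 0 0 a24) 1 \<in> ideal_of (set ps)"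
      using p5_cases ps(5) by auto
    have rule6: "a2 + a12 < A + C + D \<and> Poly_Mapping.single (mk 0 (a2 + a12) 0 0) 1 \<in> ideal_of (set ps) \<or>
        a2 + a12 = A + C + D \<and>
        Poly_Mapping.single (mk 0 (a2 + a12) 0 0) 1 - Poly_Mapping.single (mk A 0 C D) 1 \<in> ideal_of (set ps)"
      using p6_cases ps(6) by auto
    show ?thesis
      using that ps(1-4) degs rule5 rule6 A_pos pos unfolding rules_def list.set
      by (elim insertE emptyE Pair_inject) simp_all
  qed
  have join: "joinable S l r" if "(l, r) \<in> set rules" for l r
    using rewrite_stepI[OF that, of 0] by (intro joinableI[OF _ rtrancl_refl]) auto
  have rules_mem: "joinable S (mk 0 a12 0 a14) (mk a1 0 0 0)" "joinable S (mk 0 0 a23 a24) (mk 0 a2 0 0)"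
    "joinable S (mk 0 0 a3 0) (mk a31 a32 0 0)" "joinable S (mk 0 0 0 a4) (mk a41 0 a43 0)"
    "joinable S (mk 0 a12 a43 0) (mk a31 0 0 a24)"
    by (rule join, simp add: rules_def)+
  interpret SR: standard_rewriting n "set rules" "set ps"
    "(bresinsky_generators a1 a2 a3 a4 a12 a14 a23 a24 a31 a32 a41 a43 :: 'k mpoly4 set)"
  proof
    fix f :: "'k mpoly4"
    assume "f \<in> (bresinsky_generators a1 a2 a3 a4 a12 a14 a23 a24 a31 a32 a41 a43 :: 'k mpoly4 set)"
    then show "\<exists>x y. f = Poly_Mapping.single x 1 - Poly_Mapping.single y 1 \<and> joinable S x y"
      unfolding bresinsky_generators_def
      using rules_mem rules_mem[THEN joinable_sym] by (elim insertE emptyE) blast+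
  qed (use n_pos rules_weight rule_cases critical_pairs curve in simp_all)
  have "set ps \<subseteq> initial_ideal (curve_ideal n)"
  proof -
    have "Poly_Mapping.single (mk 0 a12 0 a14) 1 \<in> (initial_ideal (curve_ideal n) :: 'k mpoly4 set)"
      "Poly_Mapping.single (mk 0 0 a23 a24) 1 \<in> (initial_ideal (curve_ideal n) :: 'k mpoly4 set)"
      "Poly_Mapping.single (mk 0 0 a3 0) 1 \<in> (initial_ideal (curve_ideal n) :: 'k mpoly4 set)"
      "Poly_Mapping.single (mk 0 0 0 a4) 1 \<in> (initial_ideal (curve_ideal n) :: 'k mpoly4 set)"
      using weights degs by (simp_all add: single_mem_initial_ideal[of n _ "mk a1 0 0 0"]
        single_mem_initial_ideal[of n _ "mk 0 a2 0 0"] single_mem_initial_ideal[of n _ "mk a31 a32 0 0"]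
        single_mem_initial_ideal[of n _ "mk a41 0 a43 0"])
    moreover have "p5 \<in> initial_ideal (curve_ideal n)"
      using p5_cases weights single_mem_initial_ideal[of n "mk 0 a12 a43 0" "mk a31 0 0 a24"]
        binomial_mem_initial_ideal[of n "mk a31 0 0 a24" "mk 0 a12 a43 0"] by auto
    moreover have "p6 \<in> initial_ideal (curve_ideal n)"
      using p6_cases weights single_mem_initial_ideal[of n "mk 0 (a2 + a12) 0 0" "mk A 0 C D"]
        binomial_mem_initial_ideal[of n "mk 0 (a2 + a12) 0 0" "mk A 0 C D"] by auto
    ultimately show ?thesis
      by (simp add: ps_def)
  qed
  then have "ideal_of (set ps) \<subseteq> initial_ideal (curve_ideal n)"
    unfolding initial_ideal_def by (rule ideal_of_subset_ideal_of)
  then have "initial_ideal (curve_ideal n) = ideal_of (set ps)"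
    using SR.initial_ideal_subset by blast
  moreover have "minimally_generates ps (ideal_of (set ps))"
  proof (rule minimally_generatesI)
    \<comment> \<open>The left sides of the rules serve as the witness monomials.\<close>
    let ?ls = "map fst rules"
    have idx: "i = 0 \<or> i = 1 \<or> i = 2 \<or> i = 3 \<or> i = 4 \<or> i = 5" if "i < length ps" for i
      using that unfolding ps_def by auto
    have nth: "ps ! 0 = Poly_Mapping.single (mk 0 a12 0 a14) 1" "ps ! Suc 0 = Poly_Mapping.single (mk 0 0 a23 a24) 1"
      "ps ! 2 = Poly_Mapping.single (mk 0 0 a3 0) 1" "ps ! 3 = Poly_Mapping.single (mk 0 0 0 a4) 1"
      "ps ! 4 = p5" "ps ! 5 = p6"
      by (simp_all add: ps_def)
    have ls: "?ls ! 0 = mk 0 a12 0 a14" "?ls ! Suc 0 = mk 0 0 a23 a24" "?ls ! 2 = mk 0 0 a3 0"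
      "?ls ! 3 = mk 0 0 0 a4" "?ls ! 4 = mk 0 a12 a43 0" "?ls ! 5 = mk 0 (a2 + a12) 0 0"
      by (simp_all add: rules_def)
    have lead: "fst (rules ! 0) = mk 0 a12 0 a14" "fst (rules ! Suc 0) = mk 0 0 a23 a24" "fst (rules ! 2) = mk 0 0 a3 0"
      "fst (rules ! 3) = mk 0 0 0 a4" "fst (rules ! 4) = mk 0 a12 a43 0" "fst (rules ! 5) = mk 0 (a2 + a12) 0 0"
      by (simp_all add: rules_def)
    have coeff5: "Poly_Mapping.lookup p5 (mk 0 a12 a43 0) \<noteq> 0"
      using p5_cases pos by (auto simp: lookup_minus lookup_single)
    have coeff6: "Poly_Mapping.lookup p6 (mk 0 (a2 + a12) 0 0) \<noteq> 0"
      using p6_cases A_pos by (auto simp: lookup_minus lookup_single)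
    show "Poly_Mapping.lookup (ps ! i) (?ls ! i) \<noteq> 0" if "i < length ps" for i
      using idx[OF that] coeff5 coeff6 by (elim disjE) (simp_all add: nth ls)
    have keys5: "Poly_Mapping.keys p5 \<subseteq> {mk 0 a12 a43 0, mk a31 0 0 a24}"
      using p5_cases by (auto simp: in_keys_iff lookup_minus lookup_single when_def split: if_splits)
    have keys6: "Poly_Mapping.keys p6 \<subseteq> {mk 0 (a2 + a12) 0 0, mk A 0 C D}"
      using p6_cases by (auto simp: in_keys_iff lookup_minus lookup_single when_def split: if_splits)
    \<comment> \<open>A term other than the left side occurs only in the tie cases of
      \<open>p5\<close> and \<open>p6\<close> and contains x_1, so it divides no left side. It
      remains to see that no left side divides another.\<close>
    have ndvd: "0 < Poly_Mapping.lookup m 1 \<or> m = fst (rules ! j)"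
      if "j < length ps" "m \<in> Poly_Mapping.keys (ps ! j)" for j m
      using idx[OF that(1)] that(2) keys5 keys6 A_pos pos
      by (elim disjE) (auto simp: nth lead)
    have less: "a14 < a4" "a24 < a4" "a23 < a3" "a43 < a3" "0 < a2" "a12 < a2 + a12"
      using pos by (simp_all add: a2 a3 a4)
    have antichain: "\<not> (\<forall>k. Poly_Mapping.lookup (fst (rules ! j)) k \<le> Poly_Mapping.lookup (fst (rules ! i)) k)"
      if "i < length ps" "j < length ps" "i \<noteq> j" for i j
    proof
      assume "\<forall>k. Poly_Mapping.lookup (fst (rules ! j)) k \<le> Poly_Mapping.lookup (fst (rules ! i)) k"
      then have le: "Poly_Mapping.lookup (fst (rules ! j)) k \<le> Poly_Mapping.lookup (fst (rules ! i)) k" for k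
        by blast
      show False
        using idx[OF that(1)] idx[OF that(2)] \<open>i \<noteq> j\<close> le[of 2] le[of 3] le[of 4] pos less
        by (elim disjE) (simp_all add: lead)
    qed
    show "?ls ! i \<noteq> m + u"
      if "i < length ps" "j < length ps" "i \<noteq> j" "m \<in> Poly_Mapping.keys (ps ! j)" for i j m u
    proof
      assume eq: "?ls ! i = m + u"
      have "?ls ! i = fst (rules ! i)"
        using idx[OF that(1)] by (elim disjE) (simp_all add: ls lead)
      then have le: "Poly_Mapping.lookup m k \<le> Poly_Mapping.lookup (fst (rules ! i)) k" for k
        using eq by (metis le_add1 lookup_add)
      have "Poly_Mapping.lookup (fst (rules ! i)) 1 = 0"
        using idx[OF that(1)] by (elim disjE) (simp_all add: lead)
      then have "m = fst (rules ! j)"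
        using ndvd[of j m] that le[of 1] by simp
      then show False
        using antichain[of i j] that le by simp
    qed
  qed
  ultimately show ?thesis
    by simp
qed

end

section \<open>Bresinsky's relations between the exponents\<close>

text \<open>The binomial of \<open>x\<close> and \<open>y\<close> is in the ideal and has
  coefficient 1 at \<open>x\<close>, which is impossible if no term of a generator divides
  \<open>x\<close>.\<close>

lemma ex_dividing_generator_monomial:
  fixes F :: "'k::field mpoly4 set"
  assumes "curve_ideal n = ideal_of F"
    and "weight n x = weight n y" "x \<noteq> y"
  shows "\<exists>f\<in>F. \<exists>m\<in>Poly_Mapping.keys f. \<exists>u. x = m + u"
proof (rule ccontr)
  assume "\<not> ?thesis"
  then have *: "x \<noteq> m + u" if "f \<in> F" "m \<in> Poly_Mapping.keys f" for f m u
    using that by blast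
  have "Poly_Mapping.single x (1::'k) - Poly_Mapping.single y 1 \<in> ideal_of F"
    using assms by (simp flip: assms(1) add: binomial_mem_curve_ideal_iff)
  then have "Poly_Mapping.lookup (Poly_Mapping.single x (1::'k) - Poly_Mapping.single y 1) x = 0"
    by (rule lookup_ideal_of_eq_0) (rule *)
  then show False
    using \<open>x \<noteq> y\<close> by (simp add: lookup_minus lookup_single)
qed

lemma keys_binomial: "Poly_Mapping.keys (Poly_Mapping.single x (1::'k::field) - Poly_Mapping.single y 1) \<subseteq> {x, y}"
  by (auto simp: in_keys_iff lookup_minus lookup_single when_def split: if_splits)

text \<open>Combining the weights of f_1, f_4, f_5 equates a multiple of \<open>n 1\<close> with a
  multiple of \<open>n 4\<close>; f_2, f_3, f_5 do so for \<open>n 2\<close> and \<open>n 3\<close>.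
  A non-zero multiple would give a pure power of x_1 or x_2, of exponent below \<open>a1\<close> or
  \<open>a2\<close>, in a binomial of the ideal.\<close>

lemma bresinsky_relations:
  fixes n :: "4 \<Rightarrow> nat"
  assumes n: "\<And>i. 0 < n i"
    and w1: "a1 * n 1 = a12 * n 2 + a14 * n 4" and w2: "a2 * n 2 = a23 * n 3 + a24 * n 4"
    and w3: "a3 * n 3 = a31 * n 1 + a32 * n 2" and w4: "a4 * n 4 = a41 * n 1 + a43 * n 3"
    and w5: "a31 * n 1 + a24 * n 4 = a12 * n 2 + a43 * n 3"
    and less: "0 < a12" "a12 < a2" "0 < a14" "a14 < a4" "0 < a23" "a23 < a3" "0 < a24" "a24 < a4"
      "0 < a31" "a31 < a1" "0 < a32" "a32 < a2" "0 < a41" "a41 < a1" "0 < a43" "a43 < a3"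
    and curve: "curve_ideal n = ideal_of
        (bresinsky_generators a1 a2 a3 a4 a12 a14 a23 a24 a31 a32 a41 a43 :: 'k::field mpoly4 set)"
  shows "a1 = a31 + a41" "a2 = a12 + a32" "a3 = a23 + a43" "a4 = a14 + a24"
proof -
  let ?L = "{mk a1 0 0 0, mk 0 a12 0 a14, mk 0 a2 0 0, mk 0 0 a23 a24, mk 0 0 a3 0,
      mk a31 a32 0 0, mk 0 0 0 a4, mk a41 0 a43 0, mk a31 0 0 a24, mk 0 a12 a43 0}"
  have keys: "m \<in> ?L" if "f \<in> bresinsky_generators a1 a2 a3 a4 a12 a14 a23 a24 a31 a32 a41 a43"
    "m \<in> Poly_Mapping.keys f" for f :: "'k mpoly4" and m
    using that unfolding bresinsky_generators_def
    by (elim insertE emptyE; hypsubst) (drule subsetD[OF keys_binomial]; simp; blast)+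
  have dvd: "\<exists>l\<in>?L. \<exists>u. x = l + u" if xy: "weight n x = weight n y" "x \<noteq> y" for x y
  proof -
    obtain f m u where "f \<in> (bresinsky_generators a1 a2 a3 a4 a12 a14 a23 a24 a31 a32 a41 a43 :: 'k mpoly4 set)"
        "m \<in> Poly_Mapping.keys f" "x = m + u"
      using ex_dividing_generator_monomial[OF curve xy] by blast
    then show ?thesis
      using keys by metis
  qed
  \<comment> \<open>Among the ten terms in \<open>?L\<close>, only x_1^a1 can divide a power of x_1;
    likewise x_2^a2 for powers of x_2 below.\<close>
  have x1: "a1 \<le> c" if "c * n 1 = d * n 4" "0 < c" for c d
    using dvd[of "mk c 0 0 0" "mk 0 0 0 d"] that less by (auto dest: mk_eq_mk_add)
  have x2: "a2 \<le> c" if "c * n 2 = d * n 3" "0 < c" for c d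
    using dvd[of "mk 0 c 0 0" "mk 0 0 d 0"] that less by (auto dest: mk_eq_mk_add)
  \<comment> \<open>The signs of the differences are unknown, so absolute values provide the natural
    exponents.\<close>
  have diff: "\<bar>int a - int b\<bar> * int p = \<bar>int c - int d\<bar> * int q \<Longrightarrow>
      nat \<bar>int a - int b\<bar> * p = nat \<bar>int c - int d\<bar> * q" for a b c d p q
    by (metis abs_ge_zero nat_0_le nat_int_comparison(1) of_nat_mult)
  have abs: "\<bar>x\<bar> * int p = \<bar>y\<bar> * int q" if "x * int p = y * int q" for x y :: int and p q
    using arg_cong[OF that, of abs] by (simp add: abs_mult)
  have "(int (a31 + a41) - int a1) * int (n 1) = (int a4 - int (a14 + a24)) * int (n 4)"
    using w1 w4 w5 by (simp add: algebra_simps flip: of_nat_mult of_nat_add)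
  note e1 = diff[OF abs[OF this]]
  have "(int (a12 + a32) - int a2) * int (n 2) = (int a3 - int (a23 + a43)) * int (n 3)"
    using w2 w3 w5 by (simp add: algebra_simps flip: of_nat_mult of_nat_add)
  note e2 = diff[OF abs[OF this]]
  \<comment> \<open>Both \<open>a31\<close> and \<open>a41\<close> lie strictly between 0 and
    \<open>a1\<close>, so their sum differs from \<open>a1\<close> by less than
    \<open>a1\<close>.\<close>
  have "nat \<bar>int (a31 + a41) - int a1\<bar> = 0"
    using x1[OF e1] less by linarith
  then show "a1 = a31 + a41" "a4 = a14 + a24"
    using e1 n[of 4] by auto
  have "nat \<bar>int (a12 + a32) - int a2\<bar> = 0"
    using x2[OF e2] less by linarith
  then show "a2 = a12 + a32" "a3 = a23 + a43"
    using e2 n[of 3] by auto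
qed


theorem theorem2p25:
  fixes n :: "4 \<Rightarrow> nat"
    and a1 a2 a3 a4 a12 a14 a23 a24 a31 a32 a41 a43 :: nat
    and f1 f2 f3 f4 f5 p5 :: "'k::field mpoly4"
  assumes "0 < n 1" and "n 1 < n 2" and "n 2 < n 3" and "n 3 < n 4"
    and "Gcd {n 1, n 2, n 3, n 4} = 1"
    and "gorenstein_curve n"
    and "\<not> (\<exists>g1 g2 g3. (curve_ideal n :: 'k mpoly4 set) = ideal_of {g1, g2, g3})"
    and "cohen_macaulay_ring
           (ring_of_type_algebra Quot initial_ideal (curve_ideal n :: 'k mpoly4 set))"
    and "1 < a1" and "1 < a2" and "1 < a3" and "1 < a4"
    and "0 < a12" and "a12 < a2" and "0 < a14" and "a14 < a4"
    and "0 < a23" and "a23 < a3" and "0 < a24" and "a24 < a4"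
    and "0 < a31" and "a31 < a1" and "0 < a32" and "a32 < a2"
    and "0 < a41" and "a41 < a1" and "0 < a43" and "a43 < a3"
    and "f1 = Var 1 ^ a1 - Var 2 ^ a12 * Var 4 ^ a14"
    and "f2 = Var 2 ^ a2 - Var 3 ^ a23 * Var 4 ^ a24"
    and "f3 = Var 3 ^ a3 - Var 1 ^ a31 * Var 2 ^ a32"
    and "f4 = Var 4 ^ a4 - Var 1 ^ a41 * Var 3 ^ a43"
    and "f5 = Var 1 ^ a31 * Var 4 ^ a24 - Var 2 ^ a12 * Var 3 ^ a43"
    and "minimally_generates [f1, f2, f3, f4, f5] (curve_ideal n)"
    and "a43 \<le> a23"
    and "a12 + a43 < a31 + a24 \<Longrightarrow> p5 = Var 2 ^ a12 * Var 3 ^ a43"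
    and "a12 + a43 = a31 + a24 \<Longrightarrow> p5 = Var 1 ^ a31 * Var 4 ^ a24 - Var 2 ^ a12 * Var 3 ^ a43"
  shows
    "(a24 < a14 \<and> a3 \<le> a31 + a32 \<and> a12 + a43 \<le> a31 + a24 \<and>
      a2 + a12 \<le> a31 + (a23 - a43) + 2 * a24 \<longrightarrow>
        (let p6 = (if a2 + a12 < a31 + (a23 - a43) + 2 * a24
                   then Var 2 ^ (a2 + a12)
                   else Var 2 ^ (a2 + a12) - Var 1 ^ a31 * Var 3 ^ (a23 - a43) * Var 4 ^ (2 * a24))
         in minimally_generates
              [Var 2 ^ a12 * Var 4 ^ a14, Var 3 ^ a23 * Var 4 ^ a24, Var 3 ^ a3, Var 4 ^ a4, p5, p6]
              (initial_ideal (curve_ideal n)))) \<and>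
     (a14 \<le> a24 \<and> a3 \<le> a31 + a32 \<and> a12 + a43 \<le> a31 + a24 \<and>
      a2 + a12 \<le> a1 + a23 + (a24 - a14) \<longrightarrow>
        (let p6 = (if a2 + a12 < a1 + a23 + (a24 - a14)
                   then Var 2 ^ (a2 + a12)
                   else Var 2 ^ (a2 + a12) - Var 1 ^ a1 * Var 3 ^ a23 * Var 4 ^ (a24 - a14))
         in minimally_generates
              [Var 2 ^ a12 * Var 4 ^ a14, Var 3 ^ a23 * Var 4 ^ a24, Var 3 ^ a3, Var 4 ^ a4, p5, p6]
              (initial_ideal (curve_ideal n))))"
proof -
  let ?F = "bresinsky_generators a1 a2 a3 a4 a12 a14 a23 a24 a31 a32 a41 a43 :: 'k mpoly4 set"
  have "set [f1, f2, f3, f4, f5] = ?F"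
    unfolding assms(29-33) bresinsky_generators_def Var_power_mk mult_single mk_add by simp
  then have curve: "curve_ideal n = ideal_of ?F"
    using assms(34) unfolding minimally_generates_def by metis
  \<comment> \<open>Each generator lies in the kernel, so its two terms have equal weight; this
    yields the five relations in \<open>w\<close>.\<close>
  have "?F \<subseteq> curve_ideal n"
    unfolding curve by (rule ideal_of_superset)
  then have w: "a1 * n 1 = a12 * n 2 + a14 * n 4" "a2 * n 2 = a23 * n 3 + a24 * n 4"
      "a3 * n 3 = a31 * n 1 + a32 * n 2" "a4 * n 4 = a41 * n 1 + a43 * n 3"
      "a31 * n 1 + a24 * n 4 = a12 * n 2 + a43 * n 3"
    by (simp_all add: bresinsky_generators_def binomial_mem_curve_ideal_iff)
  have "0 < n i" for i
    using assms(1-4) UNIV_4 by (cases "i = 1 \<or> i = 2 \<or> i = 3 \<or> i = 4") auto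
  note rels = bresinsky_relations[OF this w assms(13-28) curve]
  \<comment> \<open>Kept general in \<open>A\<close>, \<open>C\<close>, \<open>D\<close>, so that
    both parts of the claim are instances.\<close>
  have exps: "gorenstein_exponents a1 a2 a3 a4 a12 a14 a23 a24 a31 a32 a41 a43 A C D"
    if "a24 < a14 \<and> A = a31 \<and> C = a23 - a43 \<and> D = 2 * a24 \<or>
      a14 \<le> a24 \<and> A = a1 \<and> C = a23 \<and> D = a24 - a14" for A C D
    using that assms rels by unfold_locales
  have p5: "a12 + a43 < a31 + a24 \<Longrightarrow> p5 = Poly_Mapping.single (mk 0 a12 a43 0) 1"
      "a12 + a43 = a31 + a24 \<Longrightarrow>
        p5 = Poly_Mapping.single (mk a31 0 0 a24) 1 - Poly_Mapping.single (mk 0 a12 a43 0) 1"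
    using assms(36,37) by (simp_all add: Var_power_mk mult_single)
  note main = gorenstein_exponents.minimally_generates_initial_ideal[OF exps assms(1-4) w curve _ _ p5]
  show ?thesis
    \<comment> \<open>Products of powers of variables become single exponent vectors; matching them
      with \<open>main\<close> then fixes the generators.\<close>
    unfolding Let_def Var_power_mk mult_single mk_add add_0_left add_0_right mult_1_left
    by (intro conjI impI; elim conjE; rule main) auto
qed

end
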